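(* Let $A$ be a $d\times d$ matrix, $b\in\mathbb C^d$ and $c\in\mathbb C$ satisfy $A^{-1}=A^*=\overline A$, $A\overline b+b=0$ and $|c|^2e^{|b|^2}=1$, and let $\mathcal C_{A,b,c}$ be the conjugation on $\mathcal F^2(\mathbb C^d)$ given by $\mathcal C_{A,b,c}(f)(z)=c\,e^{\langle z,\overline b\rangle}\overline{f(\overline{Az+b})}$. Let $\psi$ be a nonzero entire function on $\mathbb C^d$ and $\varphi$ a holomorphic self-mapping of $\mathbb C^d$. (a) $C_{\psi,\varphi,\max}$ is $\mathcal C_{A,b,c}$-selfadjoint if and only if there exist a $d\times d$ matrix $Q$, $q\in\mathbb C^d$ and $\theta\in\mathbb C$ such that $$\psi(z)=\theta e^{\langle z,\ell\rangle},\qquad\varphi(z)=Qz+q,$$ where $(AQ)^{\mathbf t}=AQ$ and $\ell=\overline{Aq}+\overline b-Q^*\overline b$. (b) If $C_{\psi,\varphi}$ is a weighted composition operator (i.e. $C_{\psi,\varphi}\preceq C_{\psi,\varphi,\max}$), then $C_{\psi,\varphi}$ is $\mathcal C_{A,b,c}$-selfadjoint if and only if $C_{\psi,\varphi}=C_{\psi,\varphi,\max}$ and $\psi,\varphi$ are of the forms in (a) with the conditions in (a).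
   Context: For $u,z\in\mathbb C^d$, $\langle u,z\rangle=\sum_j u_j\overline{z_j}$, $|z|^2=\langle z,z\rangle$. $\mathcal F^2(\mathbb C^d)$ is the Hilbert space of entire functions $f$ on $\mathbb C^d$ with $\pi^{-d}\int_{\mathbb C^d}|f|^2e^{-|z|^2}dV<\infty$, with kernels $K_z(u)=e^{\langle u,z\rangle}$. For a matrix $M$: $M^{\mathbf t}$ transpose, $\overline M$ entrywise conjugate, $M^*=\overline M^{\mathbf t}$. $T\preceq S$ means $\mathrm{dom}(T)\subseteq\mathrm{dom}(S)$ and $T=S$ on $\mathrm{dom}(T)$. $E_{\psi,\varphi}(f)=\psi\cdot(f\circ\varphi)$; $C_{\psi,\varphi,\max}$ acts by $E_{\psi,\varphi}$ on $\{f\in\mathcal F^2(\mathbb C^d):E_{\psi,\varphi}(f)\in\mathcal F^2(\mathbb C^d)\}$; a weighted composition operator $C_{\psi,\varphi}$ is any operator with $C_{\psi,\varphi}\preceq C_{\psi,\varphi,\max}$. A conjugation is an anti-linear, involutive, isometric map; for a conjugation $\mathcal C$, a closed densely defined operator $S$ is $\mathcal C$-selfadjoint if $S=\mathcal C S^*\mathcal C$. *)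

theory Defs
  imports "HOL-Analysis.Analysis"
begin

definition cinner :: "complex^'n \<Rightarrow> complex^'n \<Rightarrow> complex" where
  "cinner u z = (\<Sum>j\<in>UNIV. u$j * cnj (z$j))"

definition vconj :: "complex^'n \<Rightarrow> complex^'n" where
  "vconj v = (\<chi> j. cnj (v$j))"

definition mconj :: "complex^'n^'m \<Rightarrow> complex^'n^'m" where
  "mconj M = (\<chi> i j. cnj (M$i$j))"

definition cadjoint :: "complex^'n^'m \<Rightarrow> complex^'m^'n" where
  "cadjoint M = transpose (mconj M)"

definition entire :: "(complex^'n \<Rightarrow> complex) \<Rightarrow> bool" where
  "entire f \<longleftrightarrow> (\<forall>z. \<exists>L. (f has_derivative L) (at z) \<and> (\<forall>a v. L (a *s v) = a * L v))"

definition entire_map :: "(complex^'n \<Rightarrow> complex^'n) \<Rightarrow> bool" where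
  "entire_map \<phi> \<longleftrightarrow> (\<forall>j. entire (\<lambda>z. \<phi> z $ j))"

definition Fock :: "(complex^'n \<Rightarrow> complex) set" where
  "Fock = {f. entire f \<and>
     integrable lborel (\<lambda>z. (cmod (f z))\<^sup>2 * exp (- (norm z)\<^sup>2))}"

definition fock_inner :: "(complex^'n \<Rightarrow> complex) \<Rightarrow> (complex^'n \<Rightarrow> complex) \<Rightarrow> complex" where
  "fock_inner f g =
     integral\<^sup>L lborel (\<lambda>z. f z * cnj (g z) * complex_of_real (exp (- (norm z)\<^sup>2)))
       / complex_of_real (pi ^ CARD('n))"

definition fock_norm :: "(complex^'n \<Rightarrow> complex) \<Rightarrow> real" where
  "fock_norm f = sqrt (Re (fock_inner f f))"

type_synonym 'n fop = "(complex^'n \<Rightarrow> complex) \<Rightarrow> (complex^'n \<Rightarrow> complex) option"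

definition densely_defined :: "('n::finite) fop \<Rightarrow> bool" where
  "densely_defined S \<longleftrightarrow> dom S \<subseteq> Fock \<and>
     (\<forall>f\<in>Fock. \<forall>e>0. \<exists>g\<in>dom S. fock_norm (f - g) < e)"

definition closed_op :: "('n::finite) fop \<Rightarrow> bool" where
  "closed_op S \<longleftrightarrow> dom S \<subseteq> Fock \<and> ran S \<subseteq> Fock \<and>
     (\<forall>u f g. (\<forall>k. u k \<in> dom S) \<and> f \<in> Fock \<and> g \<in> Fock \<and>
        (\<lambda>k. fock_norm (u k - f)) \<longlonglongrightarrow> 0 \<and>
        (\<lambda>k. fock_norm (the (S (u k)) - g)) \<longlonglongrightarrow> 0 \<longrightarrow> S f = Some g)"

definition op_adjoint :: "('n::finite) fop \<Rightarrow> 'n fop" where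
  "op_adjoint S = (\<lambda>g.
     if g \<in> Fock \<and> (\<exists>h\<in>Fock. \<forall>f\<in>dom S. fock_inner (the (S f)) g = fock_inner f h)
     then Some (THE h. h \<in> Fock \<and> (\<forall>f\<in>dom S. fock_inner (the (S f)) g = fock_inner f h))
     else None)"

definition C_selfadjoint ::
  "((complex^'n \<Rightarrow> complex) \<Rightarrow> (complex^'n \<Rightarrow> complex)) \<Rightarrow> 'n fop \<Rightarrow> bool" where
  "C_selfadjoint Cj S \<longleftrightarrow> densely_defined S \<and> closed_op S \<and>
     S = (\<lambda>f. if f \<in> Fock then map_option Cj (op_adjoint S (Cj f)) else None)"

definition conjABc :: "complex^'n^'n \<Rightarrow> complex^'n \<Rightarrow> complex
     \<Rightarrow> (complex^'n \<Rightarrow> complex) \<Rightarrow> (complex^'n \<Rightarrow> complex)" where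
  "conjABc A b c f = (\<lambda>z. c * exp (cinner z (vconj b)) * cnj (f (vconj (A *v z + b))))"

definition wcomp :: "(complex^'n \<Rightarrow> complex) \<Rightarrow> (complex^'n \<Rightarrow> complex^'n)
     \<Rightarrow> (complex^'n \<Rightarrow> complex) \<Rightarrow> (complex^'n \<Rightarrow> complex)" where
  "wcomp \<psi> \<phi> f = (\<lambda>z. \<psi> z * f (\<phi> z))"

definition wco_max :: "(complex^'n \<Rightarrow> complex) \<Rightarrow> (complex^'n \<Rightarrow> complex^'n) \<Rightarrow> 'n fop" where
  "wco_max \<psi> \<phi> = (\<lambda>f. if f \<in> Fock \<and> wcomp \<psi> \<phi> f \<in> Fock then Some (wcomp \<psi> \<phi> f) else None)"

definition normal_form :: "complex^'n^'n \<Rightarrow> complex^'n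
     \<Rightarrow> (complex^'n \<Rightarrow> complex) \<Rightarrow> (complex^'n \<Rightarrow> complex^'n) \<Rightarrow> bool" where
  "normal_form A b \<psi> \<phi> \<longleftrightarrow> (\<exists>(Q::complex^'n^'n) (q::complex^'n) (\<theta>::complex).
     transpose (A ** Q) = A ** Q \<and>
     \<psi> = (\<lambda>z. \<theta> * exp (cinner z (vconj (A *v q) + vconj b - cadjoint Q *v vconj b))) \<and>
     \<phi> = (\<lambda>z. Q *v z + q))"

end

theory Submission
  imports Defs "HOL-Complex_Analysis.Complex_Analysis" "HOL-Probability.Distributions"
begin

text \<open>Neither completeness of the Fock space nor isometry of the conjugation \<open>C\<close> is needed.
  If \<open>S\<close> is \<open>C\<close>-selfadjoint and contained in the maximal operator, then \<open>S*\<close> maps \<open>K\<^sub>w\<close> to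
  \<open>cnj (\<psi> w) K\<^bsub>\<phi> w\<^esub>\<close>, and evaluating \<open>S = C S* C\<close> at \<open>C K\<^sub>w\<close> gives a functional equation for \<open>\<psi>\<close>
  and \<open>\<phi>\<close>. Its case \<open>w = 0\<close> determines \<open>\<psi>\<close>; what remains is an identity between exponents
  modulo \<open>2 \<pi> i\<close>, which by continuity is exact and says that \<open>A (\<phi> z - \<phi> 0)\<close> is symmetric for the
  bilinear dot product, hence a symmetric matrix applied to \<open>z\<close>.

  Conversely, for symbols of the given form the relation \<open>T* = C T C\<close> for the maximal
  operator \<open>T\<close> is immediate on kernel functions. To extend it to the whole maximal domain, replace \<open>h\<close>
  by \<open>h (r (z - q) + q)\<close>: the operator turns this dilation about \<open>q\<close> into a weighted dilation
  about \<open>0\<close> applied to \<open>T h\<close>, both are holomorphic in \<open>r\<close> and bounded as \<open>r\<close> tends to \<open>1\<close>, and for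
  small \<open>r\<close> everything is bounded, so that density of the kernel functions suffices. The second
  part holds because a \<open>C\<close>-selfadjoint operator has no proper \<open>C\<close>-selfadjoint extension.\<close>

section \<open>Lebesgue measure: isometries and the Gaussian integral\<close>

text \<open>The image measure \<open>\<mu>\<close> is translation invariant, so integrating
  \<open>1\<^sub>A (x) 1\<^sub>B (x + y)\<close> in both orders gives \<open>\<mu> A * \<lambda> B = \<lambda> A * \<mu> B\<close>; the unit ball serves as \<open>B\<close>.\<close>

lemma distr_lborel_isometry:
  fixes f :: "'a::euclidean_space \<Rightarrow> 'a"
  assumes lin: "linear f" and nrm: "\<And>x. norm (f x) = norm x"
  shows "distr lborel borel f = lborel"
proof (rule measure_eqI)
  have cont: "continuous_on UNIV f"
    using lin by (simp add: linear_continuous_on linear_conv_bounded_linear)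
  have mf[measurable]: "f \<in> borel \<rightarrow>\<^sub>M borel"
    by (rule borel_measurable_continuous_onI[OF cont])
  have inj: "inj f"
    using lin nrm by (metis linear_injective_0 norm_eq_zero)
  have surj: "surj f"
    using linear_injective_imp_surjective[OF lin inj] by simp
  define \<mu> where "\<mu> = distr lborel borel f"
  have vim: "f -` ball 0 r = ball 0 r" for r
    by (auto simp: nrm)
  have ballmu: "emeasure \<mu> (ball 0 r) = emeasure lborel (ball (0::'a) r)" for r
    unfolding \<mu>_def by (subst emeasure_distr) (auto simp: vim)
  have sigma: "sigma_finite_measure \<mu>"
  proof
    let ?A = "range (\<lambda>n::nat. ball (0::'a) (real n))"
    have "\<Union> ?A = UNIV"
      by (auto intro: reals_Archimedean2)
    moreover have "emeasure \<mu> a \<noteq> \<infinity>" if "a \<in> ?A" for a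
      using that emeasure_lborel_ball_finite[of "0::'a"] by (auto simp: ballmu less_top)
    ultimately show "\<exists>A. countable A \<and> A \<subseteq> sets \<mu> \<and> \<Union> A = space \<mu> \<and> (\<forall>a\<in>A. emeasure \<mu> a \<noteq> \<infinity>)"
      by (intro exI[of _ ?A]) (auto simp: \<mu>_def)
  qed
  interpret \<mu>: sigma_finite_measure \<mu> by (rule sigma)
  interpret P: pair_sigma_finite \<mu> "lborel :: 'a measure" ..
  have sets_mu[measurable_cong]: "sets \<mu> = sets borel" by (simp add: \<mu>_def)
  \<comment> \<open>Surjectivity writes \<open>c\<close> as \<open>f d\<close>; by linearity, adding
    \<open>f d\<close> after applying \<open>f\<close> is applying \<open>f\<close> after adding
    \<open>d\<close>.\<close>
  have trans_mu: "distr \<mu> borel ((+) c) = \<mu>" for c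
  proof -
    obtain d where d: "c = f d" using surj by (metis surjD)
    have "distr \<mu> borel ((+) c) = distr lborel borel ((+) c \<circ> f)"
      unfolding \<mu>_def by (subst distr_distr) auto
    also have "(+) c \<circ> f = f \<circ> (+) d"
      by (auto simp: d linear_add[OF lin])
    also have "distr lborel borel (f \<circ> (+) d) = distr (distr lborel borel ((+) d)) borel f"
      by (subst distr_distr) auto
    finally show ?thesis by (simp add: \<mu>_def lborel_distr_plus)
  qed
  have neg: "distr lborel borel (\<lambda>x::'a. - x) = lborel"
    using lborel_affine[of "-1::real" "0::'a"] by (simp add: density_1)
  fix A assume "A \<in> sets (distr lborel borel f)"
  then have A[measurable]: "A \<in> sets borel" by simp
  define B where "B = ball (0::'a) 1"
  have B[measurable]: "B \<in> sets borel" by (simp add: B_def)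
  have mc: "(\<lambda>p::'a \<times> 'a. indicator A (fst p) * indicator B (fst p + snd p) :: ennreal) \<in> borel_measurable (\<mu> \<Otimes>\<^sub>M lborel)"
    by measurable
  have mc': "(\<lambda>p::'a \<times> 'a. indicator A (fst p - snd p) * indicator B (fst p) :: ennreal) \<in> borel_measurable (\<mu> \<Otimes>\<^sub>M lborel)"
    by measurable
  have 1: "(\<integral>\<^sup>+y. indicator B (x + y) \<partial>lborel) = emeasure lborel B" for x :: 'a
  proof -
    have "(\<integral>\<^sup>+y. indicator B (x + y) \<partial>lborel) = (\<integral>\<^sup>+y. indicator B y \<partial>distr lborel borel ((+) x))"
      by (subst nn_integral_distr) auto
    then show ?thesis by (simp add: lborel_distr_plus)
  qed
  have 2: "(\<integral>\<^sup>+y. indicator A (x - y) \<partial>lborel) = emeasure lborel A" for x :: 'a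
  proof -
    have "(\<integral>\<^sup>+y. indicator A (x - y) \<partial>lborel) = (\<integral>\<^sup>+y. indicator A (x + y) \<partial>distr lborel borel (\<lambda>x::'a. - x))"
      by (subst nn_integral_distr) auto
    also have "\<dots> = (\<integral>\<^sup>+y. indicator A (x + y) \<partial>lborel)" by (simp only: neg)
    also have "\<dots> = (\<integral>\<^sup>+y. indicator A y \<partial>distr lborel borel ((+) x))"
      by (subst nn_integral_distr) auto
    finally show ?thesis by (simp add: lborel_distr_plus)
  qed
  \<comment> \<open>Translation invariance of \<open>\<mu>\<close> replaces \<open>x\<close> by
    \<open>y + x\<close> on the right, moving the shift from \<open>A\<close> to
    \<open>B\<close>.\<close>
  have 3: "(\<integral>\<^sup>+x. indicator A x * indicator B (x + y) \<partial>\<mu>) = (\<integral>\<^sup>+x. indicator A (x - y) * indicator B x \<partial>\<mu>)" for y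
  proof -
    have "(\<integral>\<^sup>+x. indicator A (x - y) * indicator B x \<partial>\<mu>) = (\<integral>\<^sup>+x. indicator A (x - y) * indicator B x \<partial>distr \<mu> borel ((+) y))"
      by (simp only: trans_mu)
    also have "\<dots> = (\<integral>\<^sup>+x. indicator A (y + x - y) * indicator B (y + x) \<partial>\<mu>)"
      by (subst nn_integral_distr) auto
    finally show ?thesis by (simp add: add.commute)
  qed
  have "emeasure \<mu> A * emeasure lborel B = (\<integral>\<^sup>+x. indicator A x * (\<integral>\<^sup>+y. indicator B (x + y) \<partial>lborel) \<partial>\<mu>)"
    by (simp add: 1 nn_integral_multc)
  also have "\<dots> = (\<integral>\<^sup>+x. \<integral>\<^sup>+y. indicator A x * indicator B (x + y) \<partial>lborel \<partial>\<mu>)"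
    by (simp add: nn_integral_cmult)
  also have "\<dots> = (\<integral>\<^sup>+y. \<integral>\<^sup>+x. indicator A x * indicator B (x + y) \<partial>\<mu> \<partial>lborel)"
    using P.Fubini[OF mc] by simp
  also have "\<dots> = (\<integral>\<^sup>+y. \<integral>\<^sup>+x. indicator A (x - y) * indicator B x \<partial>\<mu> \<partial>lborel)"
    by (simp add: 3)
  also have "\<dots> = (\<integral>\<^sup>+x. \<integral>\<^sup>+y. indicator A (x - y) * indicator B x \<partial>lborel \<partial>\<mu>)"
    using P.Fubini[OF mc'] by simp
  also have "\<dots> = emeasure lborel A * emeasure \<mu> B"
    by (simp add: nn_integral_multc 2 nn_integral_cmult)
  finally have "emeasure \<mu> A * emeasure lborel B = emeasure lborel A * emeasure lborel B"
    by (simp add: B_def ballmu)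
  moreover have "emeasure lborel B \<noteq> 0"
    unfolding B_def using negligible_iff_emeasure0[of "ball (0::'a) 1"] open_not_negligible[of "ball (0::'a) 1"]
    by simp
  moreover have "emeasure lborel B \<noteq> \<infinity>"
    unfolding B_def using emeasure_lborel_ball_finite[of "0::'a" 1] by simp
  ultimately show "emeasure (distr lborel borel f) A = emeasure lborel A"
    using ennreal_mult_cancel_left[of "emeasure lborel B" "emeasure \<mu> A" "emeasure lborel A"]
    by (simp add: \<mu>_def mult.commute)
qed simp

section \<open>The Gaussian integral\<close>

lemma nn_integral_gauss_real: "(\<integral>\<^sup>+x. ennreal (exp (- (x::real)\<^sup>2)) \<partial>lborel) = ennreal (sqrt pi)"
proof -
  \<comment> \<open>\<open>gaussian_moment_0\<close> gives the half-line integral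
    \<open>sqrt pi / 2\<close>; evenness doubles it.\<close>
  have "has_bochner_integral lborel (\<lambda>x::real. exp (- x\<^sup>2)) (2 *\<^sub>R (sqrt pi / 2))"
    by (rule has_bochner_integral_even_function[OF gaussian_moment_0]) simp
  then show ?thesis
    by (subst nn_integral_eq_integral) (auto simp: has_bochner_integral_iff)
qed

lemma nn_integral_gauss:
  "(\<integral>\<^sup>+x. ennreal (exp (- (norm (x::'a::euclidean_space))\<^sup>2)) \<partial>lborel) = ennreal (sqrt pi ^ DIM('a))"
proof -
  have "(\<integral>\<^sup>+x. ennreal (exp (- (norm (x::'a))\<^sup>2)) \<partial>lborel)
      = (\<integral>\<^sup>+x. (\<Prod>b\<in>Basis. ennreal (exp (- ((x::'a) \<bullet> b)\<^sup>2))) \<partial>lborel)"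
  proof (rule nn_integral_cong)
    fix x :: 'a
    have "(norm x)\<^sup>2 = (\<Sum>b\<in>Basis. (x \<bullet> b)\<^sup>2)"
      unfolding power2_norm_eq_inner by (subst euclidean_inner) (simp add: power2_eq_square)
    then show "ennreal (exp (- (norm x)\<^sup>2)) = (\<Prod>b\<in>Basis. ennreal (exp (- (x \<bullet> b)\<^sup>2)))"
      by (simp add: prod_ennreal exp_sum[symmetric] sum_negf)
  qed
  also have "\<dots> = (\<Prod>b\<in>(Basis::'a set). \<integral>\<^sup>+x. ennreal (exp (- (x::real)\<^sup>2)) \<partial>lborel)"
    by (subst nn_integral_lborel_prod) auto
  also have "\<dots> = ennreal (sqrt pi ^ DIM('a))"
    by (simp add: nn_integral_gauss_real ennreal_power)
  finally show ?thesis .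
qed

lemma has_bochner_integral_gauss:
  "has_bochner_integral lborel (\<lambda>z::complex^'n::finite. exp (- (norm z)\<^sup>2)) (pi ^ CARD('n))"
proof (rule has_bochner_integral_nn_integral)
  \<comment> \<open>The real dimension is twice \<open>CARD('n)\<close>, so the square roots pair
    off.\<close>
  have "sqrt pi ^ DIM(complex^'n) = (sqrt pi ^ 2) ^ CARD('n)"
    by (simp only: power_mult[symmetric]) (simp add: mult.commute)
  then have "sqrt pi ^ DIM(complex^'n) = pi ^ CARD('n)"
    by simp
  then show "(\<integral>\<^sup>+z. ennreal (exp (- (norm (z::complex^'n))\<^sup>2)) \<partial>lborel) = ennreal (pi ^ CARD('n))"
    by (simp only: nn_integral_gauss)
qed auto

section \<open>The Hermitian form and entire functions\<close>

lemma cinner_add_left: "cinner (x + y) z = cinner x z + cinner y z"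
  by (simp add: cinner_def sum.distrib distrib_right)

lemma cinner_add_right: "cinner z (x + y) = cinner z x + cinner z y"
  by (simp add: cinner_def sum.distrib distrib_left)

lemma cinner_diff_left: "cinner (x - y) z = cinner x z - cinner y z"
  by (simp add: cinner_def sum_subtractf left_diff_distrib)

lemma cinner_diff_right: "cinner z (x - y) = cinner z x - cinner z y"
  by (simp add: cinner_def sum_subtractf right_diff_distrib)

lemma cinner_scale_left: "cinner (a *s x) z = a * cinner x z"
  by (simp add: cinner_def sum_distrib_left mult.assoc)

lemma cinner_scale_right: "cinner z (a *s x) = cnj a * cinner z x"
  by (simp add: cinner_def sum_distrib_left mult.left_commute)

lemma cinner_scaleR_left: "cinner (r *\<^sub>R x) z = of_real r * cinner x z"
  by (simp add: cinner_def sum_distrib_left mult.assoc scaleR_conv_of_real[where 'a=complex])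

lemma cinner_zero [simp]: "cinner 0 z = 0" "cinner z 0 = 0"
  by (simp_all add: cinner_def)

lemma cinner_minus [simp]: "cinner (- x) z = - cinner x z" "cinner x (- z) = - cinner x z"
  by (simp_all add: cinner_def sum_negf)

lemma cnj_cinner: "cnj (cinner x y) = cinner y x"
  by (simp add: cinner_def cnj_sum mult.commute)

lemma Re_cinner: "Re (cinner x y) = x \<bullet> y"
  by (simp add: cinner_def inner_vec_def inner_complex_def)

lemma cinner_self: "cinner z z = of_real ((norm z)\<^sup>2)"
proof (rule complex_eqI)
  show "Re (cinner z z) = Re (of_real ((norm z)\<^sup>2))"
    by (simp add: Re_cinner power2_norm_eq_inner)
  show "Im (cinner z z) = Im (of_real ((norm z)\<^sup>2))"
    by (simp add: cinner_def)
qed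

text \<open>The library norm is tied to real scalars; homogeneity for complex scalars is read off
  from \<open>cinner_self\<close>.\<close>

lemma norm_scale: "norm (a *s z) = cmod a * norm (z :: complex^'n)"
proof -
  have "complex_of_real ((norm (a *s z))\<^sup>2) = of_real ((cmod a * norm z)\<^sup>2)"
    unfolding cinner_self[symmetric] cinner_scale_left cinner_scale_right
    by (simp add: cinner_self power_mult_distrib complex_norm_square[of a, unfolded of_real_power] mult_ac)
  then have "(norm (a *s z))\<^sup>2 = (cmod a * norm z)\<^sup>2"
    by (simp only: of_real_eq_iff)
  then show ?thesis by (simp add: power2_eq_iff_nonneg)
qed

text \<open>The real Cauchy-Schwarz inequality bounds only the real part of the form. Rotating
  \<open>x\<close> by the unimodular \<open>a\<close> makes the form real and nonnegative without
  changing the norm.\<close>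

lemma norm_cinner_le: "cmod (cinner x y) \<le> norm x * norm y"
proof (cases "cinner x y = 0")
  case False
  define a where "a = cnj (sgn (cinner x y))"
  have a: "cmod a = 1" using False by (simp add: a_def norm_sgn)
  have "a * cinner x y = of_real (cmod (cinner x y))"
    using False by (simp add: a_def sgn_eq complex_norm_square[symmetric] power2_eq_square mult.commute field_simps)
  then have "cmod (cinner x y) = Re (cinner (a *s x) y)"
    by (simp add: cinner_scale_left)
  also have "\<dots> \<le> norm (a *s x) * norm y"
    by (simp add: Re_cinner norm_cauchy_schwarz)
  finally show ?thesis by (simp add: norm_scale a)
qed simp

lemma cmod_exp_cinner_le: "cmod (exp (cinner x y)) \<le> exp (norm x * norm y)"
  using complex_Re_le_cmod[of "cinner x y"] norm_cinner_le[of x y] by simp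

lemma vconj_vconj [simp]: "vconj (vconj z) = z"
  by (simp add: vconj_def vec_eq_iff)

lemma vconj_add: "vconj (x + y) = vconj x + vconj y"
  by (simp add: vconj_def vec_eq_iff)

lemma vconj_diff: "vconj (x - y) = vconj x - vconj y"
  by (simp add: vconj_def vec_eq_iff)

lemma vconj_minus: "vconj (- x) = - vconj x"
  by (simp add: vconj_def vec_eq_iff)

lemma vconj_zero [simp]: "vconj 0 = 0"
  by (simp add: vconj_def vec_eq_iff)

lemma vconj_scale: "vconj (a *s x) = cnj a *s vconj x"
  by (simp add: vconj_def vec_eq_iff)

lemma cinner_vconj: "cinner (vconj x) (vconj y) = cinner y x"
  by (simp add: cinner_def vconj_def mult.commute)

lemma norm_vconj [simp]: "norm (vconj z) = norm z"
  by (simp add: norm_vec_def vconj_def)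

lemma cinner_mult_left: "cinner (M *v x) y = cinner x (cadjoint M *v y)"
proof -
  have "cinner (M *v x) y = (\<Sum>i\<in>UNIV. \<Sum>j\<in>UNIV. M$i$j * x$j * cnj (y$i))"
    by (simp add: cinner_def matrix_vector_mult_def sum_distrib_right)
  also have "\<dots> = (\<Sum>j\<in>UNIV. \<Sum>i\<in>UNIV. M$i$j * x$j * cnj (y$i))"
    by (rule sum.swap)
  also have "\<dots> = cinner x (cadjoint M *v y)"
    by (simp add: cinner_def matrix_vector_mult_def cadjoint_def transpose_def mconj_def
        cnj_sum sum_distrib_left mult_ac)
  finally show ?thesis .
qed

lemma cadjoint_cadjoint [simp]: "cadjoint (cadjoint M) = M"
  by (simp add: cadjoint_def mconj_def transpose_def vec_eq_iff)

lemma cinner_mult_right: "cinner x (M *v y) = cinner (cadjoint M *v x) y"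
  by (simp add: cinner_mult_left)

lemma vconj_mult: "vconj (M *v x) = mconj M *v vconj x"
  by (simp add: vconj_def mconj_def matrix_vector_mult_def vec_eq_iff cnj_sum)

lemma mult_scale: "M *v (a *s x) = a *s (M *v (x :: complex^'n))"
  by (simp add: matrix_vector_mult_def vec_eq_iff sum_distrib_left mult_ac)

lemma linear_cmult_vec: "linear (\<lambda>x. M *v (x :: complex^'n))"
  by (rule linearI) (auto simp: matrix_vector_mult_def vec_eq_iff algebra_simps sum.distrib
      scaleR_conv_of_real[where 'a=complex] sum_distrib_left)

lemma linear_cinner_left: "linear (\<lambda>x. cinner x y)"
  by (rule linearI) (simp_all add: cinner_add_left cinner_scaleR_left scaleR_conv_of_real[where 'a=complex])

lemma linear_cscale: "linear (\<lambda>x. a *s (x :: complex^'n))"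
  by (rule linearI) (auto simp: vec_eq_iff algebra_simps)

lemma linear_vconj: "linear vconj"
  by (rule linearI) (auto simp: vconj_def vec_eq_iff)

lemma continuous_on_cinner [continuous_intros]:
  assumes "continuous_on S f" "continuous_on S g"
  shows "continuous_on S (\<lambda>x. cinner (f x) (g x))"
  unfolding cinner_def by (intro continuous_intros assms continuous_on_vec_lambda)

lemma continuous_on_mult_vec [continuous_intros]:
  assumes "continuous_on S f"
  shows "continuous_on S (\<lambda>x. M *v (f x :: complex^'n))"
  using continuous_on_compose2[OF linear_continuous_on assms, of "\<lambda>x. M *v x" UNIV] linear_cmult_vec[of M]
  by (simp add: linear_conv_bounded_linear)

section \<open>Entire functions of several variables\<close>

lemma entireD_has_derivative:
  assumes "entire f" shows "\<exists>L. (f has_derivative L) (at z) \<and> (\<forall>a v. L (a *s v) = a * L v)"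
  using assms by (auto simp: entire_def)

lemma entire_continuous: "entire f \<Longrightarrow> continuous_on UNIV f"
  by (metis entire_def has_derivative_continuous continuous_at_imp_continuous_on)

lemma entire_measurable [measurable_dest]: "entire f \<Longrightarrow> f \<in> borel_measurable borel"
  by (intro borel_measurable_continuous_onI entire_continuous)

lemma entire_const: "entire (\<lambda>_. a)"
  unfolding entire_def by (intro allI exI[of _ "\<lambda>_. 0"]) auto

lemma entire_add:
  assumes "entire f" "entire g" shows "entire (\<lambda>z. f z + g z)"
  unfolding entire_def
proof
  fix z
  obtain L where L: "(f has_derivative L) (at z)" "\<forall>a v. L (a *s v) = a * L v"
    using entireD_has_derivative[OF assms(1)] by blast
  obtain M where M: "(g has_derivative M) (at z)" "\<forall>a v. M (a *s v) = a * M v"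
    using entireD_has_derivative[OF assms(2)] by blast
  show "\<exists>L. ((\<lambda>z. f z + g z) has_derivative L) (at z) \<and> (\<forall>a v. L (a *s v) = a * L v)"
    using has_derivative_add[OF L(1) M(1)] L(2) M(2) by (intro exI[of _ "\<lambda>x. L x + M x"]) (auto simp: algebra_simps)
qed

lemma entire_mult:
  assumes "entire f" "entire g" shows "entire (\<lambda>z. f z * g z)"
  unfolding entire_def
proof
  fix z
  obtain L where L: "(f has_derivative L) (at z)" "\<forall>a v. L (a *s v) = a * L v"
    using entireD_has_derivative[OF assms(1)] by blast
  obtain M where M: "(g has_derivative M) (at z)" "\<forall>a v. M (a *s v) = a * M v"
    using entireD_has_derivative[OF assms(2)] by blast
  show "\<exists>L. ((\<lambda>z. f z * g z) has_derivative L) (at z) \<and> (\<forall>a v. L (a *s v) = a * L v)"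
    using has_derivative_mult[OF L(1) M(1)] L(2) M(2)
    by (intro exI[of _ "\<lambda>h. f z * M h + L h * g z"]) (auto simp: algebra_simps)
qed

lemma entire_cmult: "entire f \<Longrightarrow> entire (\<lambda>z. a * f z)"
  by (rule entire_mult[OF entire_const])

lemma entire_compose_affine:
  fixes f :: "complex^'n::finite \<Rightarrow> complex" and G :: "complex^'m::finite \<Rightarrow> complex^'n"
  assumes "entire f" "linear G" "\<And>a v. G (a *s v) = a *s G v"
  shows "entire (\<lambda>z. f (G z + q))"
  unfolding entire_def
proof
  fix z
  obtain L where L: "(f has_derivative L) (at (G z + q))" "\<forall>a v. L (a *s v) = a * L v"
    using entireD_has_derivative[OF assms(1)] by blast
  have "((\<lambda>z. G z + q) has_derivative G) (at z)"
    using assms(2) by (auto intro!: derivative_eq_intros linear_imp_has_derivative)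
  then have "((\<lambda>z. f (G z + q)) has_derivative (\<lambda>v. L (G v))) (at z)"
    using has_derivative_compose L(1) by blast
  then show "\<exists>L. ((\<lambda>z. f (G z + q)) has_derivative L) (at z) \<and> (\<forall>a v. L (a *s v) = a * L v)"
    using L(2) assms(3) by auto
qed

lemma entire_affine: "entire f \<Longrightarrow> entire (\<lambda>z. f (M *v z + q))"
  by (rule entire_compose_affine[OF _ linear_cmult_vec]) (auto simp: mult_scale)

lemma entire_scaled: "entire f \<Longrightarrow> entire (\<lambda>z. f (a *s z + q))"
  by (rule entire_compose_affine[OF _ linear_cscale]) (auto simp: vec_eq_iff)

lemma entire_translate: "entire f \<Longrightarrow> entire (\<lambda>z. f (z + q))"
  using entire_scaled[of f 1 q] by simp

text \<open>The inner and the outer conjugation are both antilinear, so the composite derivative is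
  complex linear again.\<close>

lemma entire_conj_affine:
  assumes "entire f" shows "entire (\<lambda>z. cnj (f (vconj (M *v z + q))))"
  unfolding entire_def
proof
  fix z
  obtain L where L: "(f has_derivative L) (at (vconj (M *v z + q)))" "\<forall>a v. L (a *s v) = a * L v"
    using entireD_has_derivative[OF assms(1)] by blast
  have "((\<lambda>z. M *v z + q) has_derivative (\<lambda>v. M *v v)) (at z)"
    using linear_cmult_vec by (auto intro!: derivative_eq_intros linear_imp_has_derivative)
  moreover have "(vconj has_derivative vconj) (at (M *v z + q))"
    by (rule linear_imp_has_derivative[OF linear_vconj])
  ultimately have "((\<lambda>z. vconj (M *v z + q)) has_derivative (\<lambda>v. vconj (M *v v))) (at z)"
    using has_derivative_compose by blast
  then have "((\<lambda>z. f (vconj (M *v z + q))) has_derivative (\<lambda>v. L (vconj (M *v v)))) (at z)"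
    using has_derivative_compose L(1) by blast
  then have "((\<lambda>z. cnj (f (vconj (M *v z + q)))) has_derivative (\<lambda>v. cnj (L (vconj (M *v v))))) (at z)"
    using has_derivative_cnj by blast
  then show "\<exists>L. ((\<lambda>z. cnj (f (vconj (M *v z + q)))) has_derivative L) (at z) \<and> (\<forall>a v. L (a *s v) = a * L v)"
    using L(2) by (intro exI[of _ "\<lambda>v. cnj (L (vconj (M *v v)))"]) (auto simp: mult_scale vconj_scale)
qed

lemma entire_exp_cinner:
  fixes l :: "complex^'n" shows "entire (\<lambda>z. exp (cinner z l))"
  unfolding entire_def
proof
  fix z :: "complex^'n"
  have "((\<lambda>z. cinner z l) has_derivative (\<lambda>v. cinner v l)) (at z)"
    by (rule linear_imp_has_derivative[OF linear_cinner_left])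
  then have "((\<lambda>z. exp (cinner z l)) has_derivative (\<lambda>v. exp (cinner z l) * cinner v l)) (at z)"
    using has_derivative_compose[OF _ DERIV_exp[THEN has_field_derivative_imp_has_derivative], of "\<lambda>z. cinner z l"]
    by blast
  then show "\<exists>L. ((\<lambda>z. exp (cinner z l)) has_derivative L) (at z) \<and> (\<forall>a v. L (a *s v) = a * L v)"
    by (intro exI[of _ "\<lambda>v. exp (cinner z l) * cinner v l"]) (auto simp: cinner_scale_left)
qed

text \<open>Bridge to one-variable theory: along a complex line the derivative \<open>L\<close> acts
  as multiplication by \<open>L v\<close>.\<close>

lemma entire_line_holomorphic:
  assumes "entire f" shows "(\<lambda>t. f (t *s v + w)) holomorphic_on S"
proof (rule holomorphic_on_subset)
  show "(\<lambda>t. f (t *s v + w)) holomorphic_on UNIV"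
    unfolding holomorphic_on_def
  proof (intro ballI)
    fix t
    obtain L where L: "(f has_derivative L) (at (t *s v + w))" "\<forall>a v. L (a *s v) = a * L v"
      using entireD_has_derivative[OF assms(1)] by blast
    have "linear (\<lambda>t::complex. t *s v)"
      by (rule linearI) (auto simp: vec_eq_iff algebra_simps)
    then have "((\<lambda>t. t *s v + w) has_derivative (\<lambda>t. t *s v)) (at t)"
      by (auto intro!: derivative_eq_intros linear_imp_has_derivative)
    then have "((\<lambda>t. f (t *s v + w)) has_derivative (\<lambda>a. L (a *s v))) (at t)"
      using has_derivative_compose L(1) by blast
    then have "((\<lambda>t. f (t *s v + w)) has_derivative (*) (L v)) (at t)"
      using L(2) by (simp add: mult.commute[of _ "L v"])
    then show "(\<lambda>t. f (t *s v + w)) field_differentiable at t within UNIV"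
      by (auto simp: field_differentiable_def has_field_derivative_def)
  qed
qed auto

section \<open>The Fock space and its inner product\<close>

lemma FockD:
  assumes "f \<in> Fock"
  shows "entire f" "integrable lborel (\<lambda>z. (cmod (f z))\<^sup>2 * exp (- (norm z)\<^sup>2))"
  using assms by (auto simp: Fock_def)

lemma Fock_measurable [measurable_dest]: "f \<in> Fock \<Longrightarrow> f \<in> borel_measurable borel"
  using FockD(1) entire_measurable by blast

lemma integrable_fock_product:
  assumes f: "f \<in> Fock" and g: "g \<in> Fock"
  shows "integrable lborel (\<lambda>z. f z * cnj (g z) * complex_of_real (exp (- (norm z)\<^sup>2)))"
proof (rule Bochner_Integration.integrable_bound)
  show "integrable lborel (\<lambda>z. (cmod (f z))\<^sup>2 * exp (- (norm z)\<^sup>2) + (cmod (g z))\<^sup>2 * exp (- (norm z)\<^sup>2))"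
    using FockD(2)[OF f] FockD(2)[OF g] by simp
  show "(\<lambda>z. f z * cnj (g z) * complex_of_real (exp (- (norm z)\<^sup>2))) \<in> borel_measurable lborel"
    by (simp, intro borel_measurable_continuous_onI continuous_intros entire_continuous FockD(1) f g)
  have "cmod (f z) * cmod (g z) \<le> (cmod (f z))\<^sup>2 + (cmod (g z))\<^sup>2" for z
    using sum_squares_bound[of "cmod (f z)" "cmod (g z)"]
      mult_nonneg_nonneg[OF norm_ge_zero[of "f z"] norm_ge_zero[of "g z"]] by linarith
  then show "AE z in lborel. norm (f z * cnj (g z) * complex_of_real (exp (- (norm z)\<^sup>2)))
      \<le> norm ((cmod (f z))\<^sup>2 * exp (- (norm z)\<^sup>2) + (cmod (g z))\<^sup>2 * exp (- (norm z)\<^sup>2))"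
    by (simp add: norm_mult distrib_right[symmetric])
qed

lemma Fock_cmult: "f \<in> Fock \<Longrightarrow> (\<lambda>z. a * f z) \<in> Fock"
  using integrable_mult_right[of "(cmod a)\<^sup>2" lborel "\<lambda>z. (cmod (f z))\<^sup>2 * exp (- (norm z)\<^sup>2)"]
  by (auto simp: Fock_def entire_cmult norm_mult power_mult_distrib mult.assoc)

lemma Fock_add:
  assumes f: "f \<in> Fock" and g: "g \<in> Fock" shows "(\<lambda>z. f z + g z) \<in> Fock"
proof -
  have "integrable lborel (\<lambda>z. (cmod (f z + g z))\<^sup>2 * exp (- (norm z)\<^sup>2))"
  proof (rule Bochner_Integration.integrable_bound)
    show "integrable lborel (\<lambda>z. 2 * ((cmod (f z))\<^sup>2 * exp (- (norm z)\<^sup>2) + (cmod (g z))\<^sup>2 * exp (- (norm z)\<^sup>2)))"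
      using FockD(2)[OF f] FockD(2)[OF g] by simp
    show "(\<lambda>z. (cmod (f z + g z))\<^sup>2 * exp (- (norm z)\<^sup>2)) \<in> borel_measurable lborel"
      using Fock_measurable[OF f] Fock_measurable[OF g] by measurable
    have "(cmod (f z + g z))\<^sup>2 \<le> 2 * ((cmod (f z))\<^sup>2 + (cmod (g z))\<^sup>2)" for z
    proof -
      have "(cmod (f z + g z))\<^sup>2 \<le> (cmod (f z) + cmod (g z))\<^sup>2"
        by (simp add: norm_triangle_ineq power_mono)
      also have "\<dots> \<le> 2 * ((cmod (f z))\<^sup>2 + (cmod (g z))\<^sup>2)"
        using sum_squares_bound[of "cmod (f z)" "cmod (g z)"] by (simp add: power2_sum)
      finally show ?thesis .
    qed
    then show "AE z in lborel. norm ((cmod (f z + g z))\<^sup>2 * exp (- (norm z)\<^sup>2))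
      \<le> norm (2 * ((cmod (f z))\<^sup>2 * exp (- (norm z)\<^sup>2) + (cmod (g z))\<^sup>2 * exp (- (norm z)\<^sup>2)))"
      by (simp add: distrib_right[symmetric] mult.assoc[symmetric])
  qed
  then show ?thesis
    using f g by (auto simp: Fock_def entire_add)
qed

lemma Fock_diff: "f \<in> Fock \<Longrightarrow> g \<in> Fock \<Longrightarrow> (\<lambda>z. f z - g z) \<in> Fock"
  using Fock_add[OF _ Fock_cmult[of g "-1"]] by simp

lemma Fock_zero: "(\<lambda>_. 0) \<in> Fock"
  by (auto simp: Fock_def entire_const)

section \<open>Algebra of the inner product and Cauchy-Schwarz\<close>

lemma fock_inner_add_left:
  assumes "f \<in> Fock" "g \<in> Fock" "h \<in> Fock"
  shows "fock_inner (\<lambda>z. f z + g z) h = fock_inner f h + fock_inner g h"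
  using integrable_fock_product[OF assms(1,3)] integrable_fock_product[OF assms(2,3)]
  by (simp add: fock_inner_def distrib_right add_divide_distrib)

lemma fock_inner_cmult_left: "fock_inner (\<lambda>z. a * f z) h = a * fock_inner f h"
  by (simp add: fock_inner_def mult.assoc)

lemma cnj_fock_inner: "cnj (fock_inner f g) = fock_inner g f"
proof -
  have "cnj (f z * cnj (g z) * complex_of_real (exp (- (norm z)\<^sup>2)))
      = g z * cnj (f z) * complex_of_real (exp (- (norm z)\<^sup>2))" for z
    by (simp add: mult_ac)
  then have "cnj (\<integral>z. f z * cnj (g z) * complex_of_real (exp (- (norm z)\<^sup>2)) \<partial>lborel)
      = (\<integral>z. g z * cnj (f z) * complex_of_real (exp (- (norm z)\<^sup>2)) \<partial>lborel)"
    by (subst Bochner_Integration.integral_cnj[symmetric]) (simp only:)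
  then show ?thesis
    unfolding fock_inner_def complex_cnj_divide by simp
qed

lemma fock_inner_diff_left:
  assumes "f \<in> Fock" "g \<in> Fock" "h \<in> Fock"
  shows "fock_inner (\<lambda>z. f z - g z) h = fock_inner f h - fock_inner g h"
  using fock_inner_add_left[OF assms(1) Fock_cmult[OF assms(2), of "-1"] assms(3)]
    fock_inner_cmult_left[of "-1" g h] by simp

lemma fock_inner_add_right:
  assumes "f \<in> Fock" "g \<in> Fock" "h \<in> Fock"
  shows "fock_inner h (\<lambda>z. f z + g z) = fock_inner h f + fock_inner h g"
  using arg_cong[OF fock_inner_add_left[OF assms], of cnj] by (simp add: cnj_fock_inner)

lemma fock_inner_diff_right:
  assumes "f \<in> Fock" "g \<in> Fock" "h \<in> Fock"
  shows "fock_inner h (\<lambda>z. f z - g z) = fock_inner h f - fock_inner h g"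
  using arg_cong[OF fock_inner_diff_left[OF assms], of cnj] by (simp add: cnj_fock_inner)

lemma fock_inner_cmult_right: "fock_inner h (\<lambda>z. a * f z) = cnj a * fock_inner h f"
  using arg_cong[OF fock_inner_cmult_left[of a f h], of cnj] by (simp add: cnj_fock_inner)

lemma fock_inner_self:
  fixes f :: "complex^'n \<Rightarrow> complex"
  shows "fock_inner f f = complex_of_real ((\<integral>z. (cmod (f z))\<^sup>2 * exp (- (norm z)\<^sup>2) \<partial>lborel) / pi ^ CARD('n))"
proof -
  have "f z * cnj (f z) * complex_of_real (exp (- (norm z)\<^sup>2))
      = complex_of_real ((cmod (f z))\<^sup>2 * exp (- (norm z)\<^sup>2))" for z
    by (simp only: complex_norm_square[symmetric] of_real_mult)
  then show ?thesis
    unfolding fock_inner_def by (simp only: integral_complex_of_real of_real_divide)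
qed

lemma fock_norm_square:
  fixes f :: "complex^'n \<Rightarrow> complex"
  shows "(fock_norm f)\<^sup>2 = (\<integral>z. (cmod (f z))\<^sup>2 * exp (- (norm z)\<^sup>2) \<partial>lborel) / pi ^ CARD('n)"
  unfolding fock_norm_def fock_inner_self by simp

lemma fock_norm_nonneg [simp]: "0 \<le> fock_norm f"
  unfolding fock_norm_def fock_inner_self by simp

lemma fock_inner_self_norm: "fock_inner f f = complex_of_real ((fock_norm f)\<^sup>2)"
  by (simp only: fock_norm_square fock_inner_self)

lemma fock_norm_cmult: "fock_norm (\<lambda>z. a * f z) = cmod a * fock_norm f"
proof -
  have "complex_of_real ((fock_norm (\<lambda>z. a * f z))\<^sup>2) = of_real ((cmod a * fock_norm f)\<^sup>2)"
    unfolding fock_inner_self_norm[symmetric] fock_inner_cmult_left fock_inner_cmult_right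
    by (simp add: fock_inner_self_norm power_mult_distrib complex_norm_square[of a, unfolded of_real_power] mult_ac)
  then have "(fock_norm (\<lambda>z. a * f z))\<^sup>2 = (cmod a * fock_norm f)\<^sup>2"
    by (simp only: of_real_eq_iff)
  then show ?thesis by (simp add: power2_eq_iff_nonneg)
qed

lemma fock_norm_diff_square:
  assumes "f \<in> Fock" "g \<in> Fock"
  shows "(fock_norm (\<lambda>z. f z - g z))\<^sup>2 = (fock_norm f)\<^sup>2 - 2 * Re (fock_inner f g) + (fock_norm g)\<^sup>2"
proof -
  have "complex_of_real ((fock_norm (\<lambda>z. f z - g z))\<^sup>2)
      = fock_inner f f - fock_inner f g - (cnj (fock_inner f g) - fock_inner g g)"
    unfolding fock_inner_self_norm[symmetric]
    by (simp add: fock_inner_diff_left fock_inner_diff_right assms Fock_diff cnj_fock_inner)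
  from arg_cong[OF this, of Re] show ?thesis
    by (simp add: fock_inner_self_norm)
qed

text \<open>The squared norm of \<open>f - t s g\<close>, with \<open>s\<close> the inner product
  and \<open>t\<close> real, is a nonnegative quadratic in \<open>t\<close>. Definiteness of the
  norm is itself derived from this inequality later, so a \<open>g\<close> of norm zero is a
  separate case.\<close>

lemma fock_Cauchy_Schwarz:
  assumes "f \<in> Fock" "g \<in> Fock"
  shows "cmod (fock_inner f g) \<le> fock_norm f * fock_norm g"
proof -
  define s where "s = fock_inner f g"
  have main: "0 \<le> (fock_norm f)\<^sup>2 - 2 * t * (cmod s)\<^sup>2 + t\<^sup>2 * (cmod s)\<^sup>2 * (fock_norm g)\<^sup>2" for t :: real
  proof -
    have "0 \<le> (fock_norm (\<lambda>z. f z - (of_real t * s) * g z))\<^sup>2" by simp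
    also have "\<dots> = (fock_norm f)\<^sup>2 - 2 * Re (cnj (of_real t * s) * s) + (cmod (of_real t * s) * fock_norm g)\<^sup>2"
      by (subst fock_norm_diff_square) (auto simp: assms Fock_cmult fock_inner_cmult_right s_def fock_norm_cmult)
    also have "Re (cnj (of_real t * s) * s) = t * (cmod s)\<^sup>2"
      by (simp add: mult.assoc mult.commute[of "cnj s"] complex_norm_square[symmetric] flip: of_real_power)
    finally show ?thesis by (simp add: norm_mult power_mult_distrib)
  qed
  show ?thesis
  proof (cases "fock_norm g = 0")
    case True
    have "s = 0"
    proof (rule ccontr)
      assume "s \<noteq> 0"
      then have "(cmod s)\<^sup>2 > 0" by simp
      \<comment> \<open>The quadratic has become linear in \<open>t\<close>; this value of
        \<open>t\<close> is large enough to make it negative.\<close>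
      moreover have "0 \<le> (fock_norm f)\<^sup>2 - 2 * (((fock_norm f)\<^sup>2 + 1) / (cmod s)\<^sup>2) * (cmod s)\<^sup>2"
        using main[of "((fock_norm f)\<^sup>2 + 1) / (cmod s)\<^sup>2"] True by simp
      moreover have "0 \<le> (fock_norm f)\<^sup>2" by simp
      ultimately show False by (simp add: \<open>s \<noteq> 0\<close>)
    qed
    then show ?thesis by (simp add: s_def)
  next
    case False
    then have g: "(fock_norm g)\<^sup>2 > 0" by simp
    \<comment> \<open>With \<open>G\<close> the squared norm of \<open>g\<close>, the choice
      \<open>t = 1 / G\<close> is the minimum point of the quadratic.\<close>
    have "0 \<le> (fock_norm f)\<^sup>2 - 2 * (1 / G) * S + (1 / G)\<^sup>2 * S * G \<Longrightarrow> G > 0 \<Longrightarrow> S \<le> (fock_norm f)\<^sup>2 * G" for G S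
      by (simp add: power2_eq_square field_simps)
    from this[OF main g]
    have "(cmod s)\<^sup>2 \<le> (fock_norm f * fock_norm g)\<^sup>2"
      by (simp add: power_mult_distrib)
    then show ?thesis unfolding s_def by (rule power2_le_imp_le) simp
  qed
qed

lemma fock_norm_triangle_diff:
  assumes "f \<in> Fock" "g \<in> Fock"
  shows "fock_norm (\<lambda>z. f z - g z) \<le> fock_norm f + fock_norm g"
proof (rule power2_le_imp_le)
  have "- Re (fock_inner f g) \<le> fock_norm f * fock_norm g"
    using fock_Cauchy_Schwarz[OF assms] abs_Re_le_cmod[of "fock_inner f g"] by linarith
  then show "(fock_norm (\<lambda>z. f z - g z))\<^sup>2 \<le> (fock_norm f + fock_norm g)\<^sup>2"
    by (simp add: fock_norm_diff_square[OF assms] power2_sum)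
qed simp

lemma fock_parallelogram:
  assumes "f \<in> Fock" "g \<in> Fock"
  shows "(fock_norm (\<lambda>z. f z - g z))\<^sup>2 + (fock_norm (\<lambda>z. f z + g z))\<^sup>2 = 2 * (fock_norm f)\<^sup>2 + 2 * (fock_norm g)\<^sup>2"
  using fock_norm_diff_square[OF assms]
    fock_norm_diff_square[OF assms(1) Fock_cmult[OF assms(2), of "-1"]]
    fock_inner_cmult_right[of f "-1" g] fock_norm_cmult[of "-1" g]
  by simp

section \<open>Reproducing kernels and their density\<close>

text \<open>Cauchy's formula at the centre of the unit circle: the derivative of the parametrisation
  cancels the Cauchy kernel up to the constant \<open>2 * pi * \<i>\<close>.\<close>

lemma circle_mean_value:
  assumes "h holomorphic_on UNIV"
  shows "((\<lambda>t. h (cis (2 * pi * t))) has_integral h 0) {0..1}"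
proof -
  have "((\<lambda>u. h u / (u - 0)) has_contour_integral (2 * of_real pi * \<i> * h 0)) (circlepath 0 1)"
    by (rule Cauchy_integral_circlepath_simple) (use assms holomorphic_on_subset in auto)
  then have "((\<lambda>x. h (circlepath 0 1 x) / circlepath 0 1 x * vector_derivative (circlepath 0 1) (at x within {0..1}))
      has_integral (2 * of_real pi * \<i> * h 0)) {0..1}"
    by (simp add: has_contour_integral_def)
  then have "((\<lambda>x. 2 * of_real pi * \<i> * h (cis (2 * pi * x))) has_integral (2 * of_real pi * \<i> * h 0)) {0..1}"
  proof (rule has_integral_eq[rotated])
    fix x :: real assume "x \<in> {0..1}"
    then show "h (circlepath 0 1 x) / circlepath 0 1 x * vector_derivative (circlepath 0 1) (at x within {0..1})
        = 2 * of_real pi * \<i> * h (cis (2 * pi * x))"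
      by (simp add: vector_derivative_circlepath01) (simp add: circlepath cis_conv_exp mult_ac)
  qed
  from has_integral_mult_right[OF this, of "1 / (2 * of_real pi * \<i>)"]
  show ?thesis by simp
qed

text \<open>Multiplication by a unimodular scalar preserves Lebesgue measure and the Gaussian
  weight. Averaging over all such rotations replaces \<open>g z\<close> by its mean over a circle in
  the complex line through \<open>z\<close>, which is \<open>g 0\<close>.\<close>

lemma gauss_mean_value:
  fixes g :: "complex^'n \<Rightarrow> complex"
  assumes ent: "entire g" and int: "integrable lborel (\<lambda>z. g z * complex_of_real (exp (- (norm z)\<^sup>2)))"
  shows "(\<integral>z. g z * complex_of_real (exp (- (norm z)\<^sup>2)) \<partial>lborel) = of_real (pi ^ CARD('n)) * g 0"
proof -
  define G where "G z = g z * complex_of_real (exp (- (norm z)\<^sup>2))" for z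
  \<comment> \<open>The indicator turns the average over the rotation parameter into an integral
    over all of the real line, ready for Fubini.\<close>
  define H where "H t z = indicator {0..1::real} t *\<^sub>R G (cis (2 * pi * t) *s z)" for t z
  have cg: "continuous_on UNIV g" by (rule entire_continuous[OF ent])
  have cG: "continuous_on UNIV G" unfolding G_def by (intro continuous_intros cg)
  have mG[measurable]: "G \<in> borel_measurable borel"
    by (rule borel_measurable_continuous_onI[OF cG])
  have iG: "integrable lborel G" using int by (simp add: G_def[abs_def])
  have rot: "distr lborel borel (\<lambda>z::complex^'n. cis (2 * pi * t) *s z) = lborel" for t
    by (rule distr_lborel_isometry[OF linear_cscale]) (simp add: norm_scale)
  have mrot[measurable]: "(\<lambda>z::complex^'n. cis (2 * pi * t) *s z) \<in> borel \<rightarrow>\<^sub>M borel" for t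
    by (intro borel_measurable_continuous_onI linear_continuous_on)
      (use linear_cscale in \<open>auto simp: linear_conv_bounded_linear\<close>)
  have int_rot: "(\<integral>z. G (cis (2 * pi * t) *s z) \<partial>lborel) = (\<integral>z. G z \<partial>lborel)"
    and intnorm_rot: "(\<integral>z. norm (G (cis (2 * pi * t) *s z)) \<partial>lborel) = (\<integral>z. norm (G z) \<partial>lborel)"
    and int'_rot: "integrable lborel (\<lambda>z. G (cis (2 * pi * t) *s z))" for t
  proof -
    have "(\<integral>z. G z \<partial>distr lborel borel (\<lambda>z::complex^'n. cis (2 * pi * t) *s z)) = (\<integral>z. G (cis (2 * pi * t) *s z) \<partial>lborel)"
      by (subst integral_distr) auto
    then show "(\<integral>z. G (cis (2 * pi * t) *s z) \<partial>lborel) = (\<integral>z. G z \<partial>lborel)" by (simp add: rot)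
    have "(\<integral>z. norm (G z) \<partial>distr lborel borel (\<lambda>z::complex^'n. cis (2 * pi * t) *s z)) = (\<integral>z. norm (G (cis (2 * pi * t) *s z)) \<partial>lborel)"
      by (subst integral_distr) auto
    then show "(\<integral>z. norm (G (cis (2 * pi * t) *s z)) \<partial>lborel) = (\<integral>z. norm (G z) \<partial>lborel)" by (simp add: rot)
    have "integrable (distr lborel borel (\<lambda>z::complex^'n. cis (2 * pi * t) *s z)) G" by (simp add: rot iG)
    then show "integrable lborel (\<lambda>z. G (cis (2 * pi * t) *s z))"
      by (subst (asm) integrable_distr_eq) auto
  qed
  have mH[measurable]: "(\<lambda>(t, z). H t z) \<in> borel_measurable (lborel \<Otimes>\<^sub>M lborel)"
  proof -
    have c: "continuous_on UNIV (\<lambda>p::real \<times> (complex^'n). cis (2 * pi * fst p) *s snd p)"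
      unfolding vector_scalar_mult_def
      by (intro continuous_on_vec_lambda continuous_intros)
    have "continuous_on UNIV (\<lambda>p::real \<times> (complex^'n). G (cis (2 * pi * fst p) *s snd p))"
      by (rule continuous_on_compose2[OF cG c]) auto
    then have [measurable]: "(\<lambda>p::real \<times> (complex^'n). G (cis (2 * pi * fst p) *s snd p)) \<in> borel_measurable borel"
      by (rule borel_measurable_continuous_onI)
    have [measurable]: "(\<lambda>p::real \<times> (complex^'n). G (cis (2 * pi * fst p) *s snd p)) \<in> borel_measurable (borel \<Otimes>\<^sub>M borel)"
      by (simp add: borel_prod)
    have "(\<lambda>p::real \<times> (complex^'n). indicator {0..1::real} (fst p) *\<^sub>R G (cis (2 * pi * fst p) *s snd p)) \<in> borel_measurable (lborel \<Otimes>\<^sub>M lborel)"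
      by measurable
    then show ?thesis by (simp add: H_def split_beta')
  qed
  have iH: "integrable (lborel \<Otimes>\<^sub>M lborel) (\<lambda>(t, z). H t z)"
  proof (rule lborel_pair.Fubini_integrable)
    have "(\<integral>z. norm (H t z) \<partial>lborel) = indicator {0..1} t *\<^sub>R (\<integral>z. norm (G z) \<partial>lborel)" for t
      by (simp add: H_def intnorm_rot)
    moreover have "integrable lborel (\<lambda>t::real. indicator {0..1} t *\<^sub>R (\<integral>z. norm (G z) \<partial>lborel))"
      by (intro integrable_scaleR_left) auto
    ultimately show "integrable lborel (\<lambda>x. LBINT y. norm (case (x, y) of (t, z) \<Rightarrow> H t z))" by simp
    show "AE x in lborel. integrable lborel (\<lambda>y. case (x, y) of (t, z) \<Rightarrow> H t z)"
      by (simp add: H_def int'_rot)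
  qed (rule mH)
  have inner: "(\<integral>t. H t z \<partial>lborel) = g 0 * complex_of_real (exp (- (norm z)\<^sup>2))" for z
  proof -
    have "((\<lambda>t. g (cis (2 * pi * t) *s z + 0)) has_integral g (0 *s z + 0)) {0..1}"
      by (rule circle_mean_value[OF entire_line_holomorphic[OF ent]])
    then have hi: "((\<lambda>t. g (cis (2 * pi * t) *s z)) has_integral g 0) {0..1}" by simp
    have "continuous_on {0..1} (\<lambda>t. g (cis (2 * pi * t) *s z))"
      by (rule continuous_on_compose2[OF cg])
        (auto simp: vector_scalar_mult_def intro!: continuous_intros continuous_on_vec_lambda)
    then have si: "set_integrable lborel {0..1} (\<lambda>t. g (cis (2 * pi * t) *s z))"
      by (rule borel_integrable_atLeastAtMost')
    have "(LINT t:{0..1}|lborel. g (cis (2 * pi * t) *s z)) = g 0"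
      using set_borel_integral_eq_integral(2)[OF si] hi by (simp add: integral_unique)
    moreover have "(\<integral>t. H t z \<partial>lborel) = (LINT t:{0..1}|lborel. g (cis (2 * pi * t) *s z)) * complex_of_real (exp (- (norm z)\<^sup>2))"
      unfolding set_lebesgue_integral_def H_def G_def by (simp add: norm_scale mult.assoc flip: integral_mult_left_zero)
    ultimately show ?thesis by simp
  qed
  have "(\<integral>z. \<integral>t. H t z \<partial>lborel \<partial>lborel) = (\<integral>t. \<integral>z. H t z \<partial>lborel \<partial>lborel)"
    by (rule lborel_pair.Fubini_integral[OF iH])
  also have "\<dots> = (\<integral>t. indicator {0..1::real} t *\<^sub>R (\<integral>z. G z \<partial>lborel) \<partial>lborel)"
    by (simp add: H_def int_rot)
  also have "\<dots> = (\<integral>z. G z \<partial>lborel)"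
    by (subst integral_scaleR_left) auto
  finally have "(\<integral>z. G z \<partial>lborel) = g 0 * (\<integral>z. complex_of_real (exp (- (norm (z::complex^'n))\<^sup>2)) \<partial>lborel)"
    by (simp add: inner)
  moreover have "(\<integral>z. exp (- (norm (z::complex^'n))\<^sup>2) \<partial>lborel) = pi ^ CARD('n)"
    using has_bochner_integral_gauss by (rule has_bochner_integral_integral_eq)
  ultimately show ?thesis
    by (simp only: G_def integral_complex_of_real mult.commute)
qed

section \<open>Affine changes of variable and a growth criterion\<close>

lemma lborel_affine_change:
  fixes f :: "'a::euclidean_space \<Rightarrow> 'b::{banach, second_countable_topology}"
  assumes s: "s \<noteq> 0" and m[measurable]: "f \<in> borel_measurable borel"
  shows integrable_lborel_affine_iff: "integrable lborel (\<lambda>z. f (t + s *\<^sub>R z)) \<longleftrightarrow> integrable lborel f"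
    and integral_lborel_affine: "(\<integral>z. f z \<partial>lborel) = \<bar>s\<bar> ^ DIM('a) *\<^sub>R (\<integral>z. f (t + s *\<^sub>R z) \<partial>lborel)"
proof -
  have p: "\<bar>s\<bar> ^ DIM('a) > 0" using s by simp
  have eq: "lborel = density (distr lborel borel (\<lambda>z::'a. t + s *\<^sub>R z)) (\<lambda>_. ennreal (\<bar>s\<bar> ^ DIM('a)))"
    using lborel_affine[OF s, of t] by (simp add: ennreal_power)
  have "integrable lborel f \<longleftrightarrow> integrable (density (distr lborel borel (\<lambda>z::'a. t + s *\<^sub>R z)) (\<lambda>_. ennreal (\<bar>s\<bar> ^ DIM('a)))) f"
    by (simp only: eq[symmetric])
  also have "\<dots> \<longleftrightarrow> integrable lborel (\<lambda>z. f (t + s *\<^sub>R z))"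
  proof -
    have "integrable lborel (\<lambda>z. f (t + s *\<^sub>R z))" if "integrable lborel (\<lambda>z. \<bar>s\<bar> ^ DIM('a) *\<^sub>R f (t + s *\<^sub>R z))"
      using integrable_scaleR_right[OF that, of "1 / \<bar>s\<bar> ^ DIM('a)"] p by simp
    then show ?thesis
      using p by (subst integrable_density) (auto simp: integrable_distr_eq)
  qed
  finally show "integrable lborel (\<lambda>z. f (t + s *\<^sub>R z)) \<longleftrightarrow> integrable lborel f" by simp
  have "(\<integral>z. f z \<partial>lborel) = (\<integral>z. f z \<partial>density (distr lborel borel (\<lambda>z::'a. t + s *\<^sub>R z)) (\<lambda>_. ennreal (\<bar>s\<bar> ^ DIM('a))))"
    by (simp only: eq[symmetric])
  also have "\<dots> = \<bar>s\<bar> ^ DIM('a) *\<^sub>R (\<integral>z. f (t + s *\<^sub>R z) \<partial>lborel)"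
    by (subst integral_density) (auto simp: integral_distr)
  finally show "(\<integral>z. f z \<partial>lborel) = \<bar>s\<bar> ^ DIM('a) *\<^sub>R (\<integral>z. f (t + s *\<^sub>R z) \<partial>lborel)" .
qed

lemma integrable_gauss_scaled:
  assumes "\<epsilon> > 0"
  shows "integrable lborel (\<lambda>z::complex^'n::finite. exp (- \<epsilon> * (norm z)\<^sup>2))"
proof -
  have "integrable lborel (\<lambda>z::complex^'n. exp (- (norm (0 + sqrt \<epsilon> *\<^sub>R z))\<^sup>2))"
    using assms has_bochner_integral_gauss[where 'n='n]
    by (subst integrable_lborel_affine_iff) (auto simp: has_bochner_integral_iff)
  then show ?thesis using assms by (simp add: power_mult_distrib)
qed

text \<open>Growth of order \<open>exp (\<rho>\<^sup>2 * (norm z)\<^sup>2 / 2)\<close> with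
  \<open>\<rho> < 1\<close>, even with a linear exponent added, leaves a Gaussian majorant.
  \<open>N\<close> is obtained before \<open>u\<close>, so it bounds a whole family at once.\<close>

lemma Fock_growth:
  assumes \<rho>: "0 \<le> \<rho>" "\<rho> < (1::real)" and C: "0 \<le> C"
  obtains N where "\<And>u :: complex^'n::finite \<Rightarrow> complex. entire u \<Longrightarrow>
      (\<And>z. cmod (u z) \<le> C * exp (a * norm z + (\<rho> * norm z + p)\<^sup>2 / 2)) \<Longrightarrow>
      u \<in> Fock \<and> fock_norm u \<le> N"
proof -
  \<comment> \<open>The quadratic decay left over is \<open>2 * \<epsilon>\<close>. One half absorbs
    the linear term \<open>B * x\<close> by completing the square; the other half keeps the majorant
    integrable.\<close>
  define \<epsilon> where "\<epsilon> = (1 - \<rho>\<^sup>2) / 2"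
  have \<epsilon>: "\<epsilon> > 0" using \<rho> by (simp add: \<epsilon>_def abs_square_less_1)
  define B where "B = 2 * a + 2 * \<rho> * p"
  define K where "K = C\<^sup>2 * exp (p\<^sup>2 + B\<^sup>2 / (4 * \<epsilon>))"
  have bd: "(C * exp (a * x + (\<rho> * x + p)\<^sup>2 / 2))\<^sup>2 * exp (- x\<^sup>2) \<le> K * exp (- \<epsilon> * x\<^sup>2)" for x
  proof -
    have "0 \<le> (2 * \<epsilon> * x - B)\<^sup>2 / (4 * \<epsilon>)" using \<epsilon> by simp
    also have "\<dots> = \<epsilon> * x\<^sup>2 - B * x + B\<^sup>2 / (4 * \<epsilon>)"
      using \<epsilon> by (simp add: power2_eq_square field_simps)
    finally have q: "B * x \<le> \<epsilon> * x\<^sup>2 + B\<^sup>2 / (4 * \<epsilon>)" by simp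
    have r: "\<rho>\<^sup>2 = 1 - 2 * \<epsilon>" by (simp add: \<epsilon>_def field_simps)
    have "2 * (a * x + (\<rho> * x + p)\<^sup>2 / 2) - x\<^sup>2 = B * x + p\<^sup>2 + \<rho>\<^sup>2 * x\<^sup>2 - x\<^sup>2"
      by (simp add: B_def power2_sum power_mult_distrib algebra_simps)
    also have "\<dots> = B * x + p\<^sup>2 - 2 * \<epsilon> * x\<^sup>2" by (simp add: r algebra_simps)
    also have "\<dots> \<le> (p\<^sup>2 + B\<^sup>2 / (4 * \<epsilon>)) + - \<epsilon> * x\<^sup>2" using q by simp
    finally have "exp (2 * (a * x + (\<rho> * x + p)\<^sup>2 / 2) - x\<^sup>2) \<le> exp ((p\<^sup>2 + B\<^sup>2 / (4 * \<epsilon>)) + - \<epsilon> * x\<^sup>2)"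
      by simp
    then have "exp (2 * (a * x + (\<rho> * x + p)\<^sup>2 / 2)) * exp (- x\<^sup>2) \<le> exp (p\<^sup>2 + B\<^sup>2 / (4 * \<epsilon>)) * exp (- \<epsilon> * x\<^sup>2)"
      by (simp only: exp_add[symmetric] diff_conv_add_uminus)
    then have "C\<^sup>2 * (exp (2 * (a * x + (\<rho> * x + p)\<^sup>2 / 2)) * exp (- x\<^sup>2)) \<le> C\<^sup>2 * (exp (p\<^sup>2 + B\<^sup>2 / (4 * \<epsilon>)) * exp (- \<epsilon> * x\<^sup>2))"
      by (intro mult_left_mono) auto
    moreover have "(exp y)\<^sup>2 = exp (2 * y)" for y :: real by (simp add: exp_double)
    ultimately show ?thesis by (simp only: K_def power_mult_distrib mult.assoc)
  qed
  define I where "I = (\<integral>z. K * exp (- \<epsilon> * (norm (z::complex^'n))\<^sup>2) \<partial>lborel)"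
  have iK: "integrable lborel (\<lambda>z::complex^'n. K * exp (- \<epsilon> * (norm z)\<^sup>2))"
    using integrable_gauss_scaled[OF \<epsilon>] by (intro integrable_mult_right) auto
  show thesis
  proof (rule that[of "sqrt (I / pi ^ CARD('n))"])
    fix u :: "complex^'n \<Rightarrow> complex"
    assume ent: "entire u" and le: "\<And>z. cmod (u z) \<le> C * exp (a * norm z + (\<rho> * norm z + p)\<^sup>2 / 2)"
    have le2: "(cmod (u z))\<^sup>2 * exp (- (norm z)\<^sup>2) \<le> K * exp (- \<epsilon> * (norm z)\<^sup>2)" for z
      using power_mono[OF le norm_ge_zero, of z 2] bd[of "norm z"]
      by (meson exp_ge_zero mult_right_mono order_trans)
    have int: "integrable lborel (\<lambda>z. (cmod (u z))\<^sup>2 * exp (- (norm z)\<^sup>2))"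
    proof (rule Bochner_Integration.integrable_bound[OF iK])
      show "(\<lambda>z. (cmod (u z))\<^sup>2 * exp (- (norm z)\<^sup>2)) \<in> borel_measurable lborel"
        using entire_measurable[OF ent] by measurable
      show "AE z in lborel. norm ((cmod (u z))\<^sup>2 * exp (- (norm z)\<^sup>2)) \<le> norm (K * exp (- \<epsilon> * (norm z)\<^sup>2))"
        using le2 by (auto intro!: AE_I2 order_trans[OF _ abs_ge_self])
    qed
    have "(fock_norm u)\<^sup>2 \<le> I / pi ^ CARD('n)"
      unfolding fock_norm_square I_def
      by (intro divide_right_mono integral_mono int iK le2) auto
    then show "u \<in> Fock \<and> fock_norm u \<le> sqrt (I / pi ^ CARD('n))"
      using ent int by (auto simp: Fock_def intro: real_le_rsqrt)
  qed
qed

section \<open>Reproducing kernels and pointwise estimates\<close>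

definition fock_kernel :: "complex^'n \<Rightarrow> complex^'n \<Rightarrow> complex" where
  "fock_kernel w = (\<lambda>u. exp (cinner u w))"

lemma fock_kernel_Fock: "fock_kernel w \<in> Fock"
proof -
  have "cmod (fock_kernel w z) \<le> 1 * exp (norm w * norm z + (0 * norm z + 0)\<^sup>2 / 2)" for z
    using cmod_exp_cinner_le[of z w] by (simp add: fock_kernel_def mult.commute)
  moreover have "entire (fock_kernel w)"
    by (simp add: fock_kernel_def entire_exp_cinner)
  ultimately show ?thesis
    using Fock_growth[of 0 1 "norm w" 0] by (metis le_numeral_extra(3) zero_less_one zero_le_one)
qed

text \<open>After the translation \<open>u = w + v\<close> the conjugated kernel cancels the
  antiholomorphic cross term of the Gaussian. What remains is an entire \<open>g\<close> against the
  centred Gaussian, with \<open>g 0 = f w\<close>.\<close>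

lemma fock_reproducing:
  assumes f: "f \<in> Fock"
  shows "fock_inner f (fock_kernel w) = f w"
proof -
  let ?F = "\<lambda>u. f u * cnj (fock_kernel w u) * complex_of_real (exp (- (norm u)\<^sup>2))"
  define g where "g v = f (v + w) * exp (cinner v (- w))" for v
  have iF: "integrable lborel ?F"
    by (rule integrable_fock_product[OF f fock_kernel_Fock])
  have shift: "?F (w + 1 *\<^sub>R v) = g v * complex_of_real (exp (- (norm v)\<^sup>2))" for v
  proof -
    have "complex_of_real (- (norm (w + v))\<^sup>2) = - (cinner w w + cinner w v + cinner v w + cinner v v)"
      unfolding of_real_minus cinner_self[symmetric] cinner_add_left cinner_add_right by simp
    then have "cinner w (w + v) + complex_of_real (- (norm (w + v))\<^sup>2) = cinner v (- w) + complex_of_real (- (norm v)\<^sup>2)"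
      by (simp add: cinner_self[symmetric] cinner_add_right del: of_real_power)
    then have "exp (cinner w (w + v)) * exp (complex_of_real (- (norm (w + v))\<^sup>2))
        = exp (cinner v (- w)) * exp (complex_of_real (- (norm v)\<^sup>2))"
      by (simp only: exp_add[symmetric])
    then show ?thesis
      unfolding g_def fock_kernel_def exp_cnj cnj_cinner exp_of_real[symmetric]
      by (simp add: mult.assoc add.commute)
  qed
  have "integrable lborel (\<lambda>v. ?F (w + 1 *\<^sub>R v))"
    using iF by (subst integrable_lborel_affine_iff) (auto dest: borel_measurable_integrable)
  then have ig: "integrable lborel (\<lambda>v. g v * complex_of_real (exp (- (norm v)\<^sup>2)))"
    by (simp only: shift)
  have "entire g"
    unfolding g_def by (intro entire_mult entire_translate entire_exp_cinner FockD(1)[OF f])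
  have "(\<integral>u. ?F u \<partial>lborel) = (\<integral>v. ?F (w + 1 *\<^sub>R v) \<partial>lborel)"
    using borel_measurable_integrable[OF iF] by (subst integral_lborel_affine[of 1 _ w]) auto
  also have "\<dots> = of_real (pi ^ CARD('a)) * g 0"
    unfolding shift by (rule gauss_mean_value[OF \<open>entire g\<close> ig])
  finally show ?thesis
    by (simp add: fock_inner_def g_def)
qed

lemma fock_reproducing_right: "f \<in> Fock \<Longrightarrow> fock_inner (fock_kernel w) f = cnj (f w)"
  using arg_cong[OF fock_reproducing[of f w], of cnj] by (simp only: cnj_fock_inner)

lemma fock_norm_kernel: "(fock_norm (fock_kernel w))\<^sup>2 = exp ((norm w)\<^sup>2)"
proof -
  have "complex_of_real ((fock_norm (fock_kernel w))\<^sup>2) = exp (cinner w w)"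
    unfolding fock_inner_self_norm[symmetric] fock_reproducing[OF fock_kernel_Fock] by (simp add: fock_kernel_def)
  also have "\<dots> = complex_of_real (exp ((norm w)\<^sup>2))"
    by (simp only: cinner_self exp_of_real)
  finally show ?thesis by (simp only: of_real_eq_iff)
qed

text \<open>Cauchy-Schwarz against the kernel. Hence norm convergence implies pointwise convergence,
  and the norm is definite.\<close>

lemma fock_pointwise:
  assumes "f \<in> Fock"
  shows "cmod (f w) \<le> fock_norm f * exp ((norm w)\<^sup>2 / 2)"
proof -
  have "(exp ((norm w)\<^sup>2 / 2))\<^sup>2 = exp ((norm w)\<^sup>2)"
    by (simp add: exp_double[symmetric])
  then have "fock_norm (fock_kernel w) = exp ((norm w)\<^sup>2 / 2)"
    using fock_norm_kernel[of w] by (metis exp_ge_zero fock_norm_nonneg power2_eq_iff_nonneg)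
  then show ?thesis
    using fock_Cauchy_Schwarz[OF assms fock_kernel_Fock[of w]] by (simp add: fock_reproducing[OF assms])
qed

lemma fock_norm_eq_0:
  assumes "f \<in> Fock" "fock_norm f = 0" shows "f = (\<lambda>_. 0)"
  using fock_pointwise[OF assms(1)] assms(2) by auto

lemma nn_integral_fock_norm:
  fixes f :: "complex^'n \<Rightarrow> complex"
  assumes "f \<in> Fock"
  shows "(\<integral>\<^sup>+z. ennreal ((cmod (f z))\<^sup>2 * exp (- (norm z)\<^sup>2)) \<partial>lborel) = ennreal ((fock_norm f)\<^sup>2 * pi ^ CARD('n))"
  using FockD(2)[OF assms] by (subst nn_integral_eq_integral) (auto simp: fock_norm_square)

text \<open>Fatou's lemma makes the norm lower semicontinuous for pointwise convergence.\<close>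

lemma fock_norm_Fatou:
  fixes u :: "nat \<Rightarrow> complex^'n \<Rightarrow> complex"
  assumes u: "\<And>m. u m \<in> Fock" and f: "f \<in> Fock"
    and lim: "\<And>z. (\<lambda>m. u m z) \<longlonglongrightarrow> f z" and le: "\<And>m. fock_norm (u m) \<le> C"
  shows "fock_norm f \<le> C"
proof -
  have C: "0 \<le> C" using le[of 0] fock_norm_nonneg order_trans by blast
  define U where "U m z = ennreal ((cmod (u m z))\<^sup>2 * exp (- (norm z)\<^sup>2))" for m z
  have [measurable]: "U m \<in> borel_measurable lborel" for m
    unfolding U_def using Fock_measurable[OF u] by measurable
  have "liminf (\<lambda>m. U m z) = ennreal ((cmod (f z))\<^sup>2 * exp (- (norm z)\<^sup>2))" for z
    unfolding U_def by (intro lim_imp_Liminf tendsto_intros tendsto_ennrealI lim) simp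
  then have "ennreal ((fock_norm f)\<^sup>2 * pi ^ CARD('n)) = (\<integral>\<^sup>+z. liminf (\<lambda>m. U m z) \<partial>lborel)"
    by (simp add: nn_integral_fock_norm[OF f])
  also have "\<dots> \<le> liminf (\<lambda>m. \<integral>\<^sup>+z. U m z \<partial>lborel)"
    by (rule nn_integral_liminf) simp
  also have "\<dots> \<le> liminf (\<lambda>m. ennreal (C\<^sup>2 * pi ^ CARD('n)))"
  proof (rule Liminf_mono, rule always_eventually, rule allI)
    fix m
    show "(\<integral>\<^sup>+z. U m z \<partial>lborel) \<le> ennreal (C\<^sup>2 * pi ^ CARD('n))"
      unfolding U_def nn_integral_fock_norm[OF u]
      by (intro ennreal_leI mult_right_mono power_mono le) auto
  qed
  also have "\<dots> = ennreal (C\<^sup>2 * pi ^ CARD('n))" by (simp add: Liminf_const)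
  finally have "(fock_norm f)\<^sup>2 * pi ^ CARD('n) \<le> C\<^sup>2 * pi ^ CARD('n)"
    by (subst (asm) ennreal_le_iff) auto
  then have "(fock_norm f)\<^sup>2 \<le> C\<^sup>2" by simp
  then show ?thesis using C by (rule power2_le_imp_le)
qed

section \<open>Density of the kernel functions\<close>

text \<open>Linear combinations grow by one kernel at a time, so that linear and conjugate-linear
  identities follow by induction from their value on a single kernel.\<close>

inductive_set kernel_span :: "(complex^'n \<Rightarrow> complex) set" where
  zero: "(\<lambda>_. 0) \<in> kernel_span"
| step: "g \<in> kernel_span \<Longrightarrow> (\<lambda>z. g z + a * fock_kernel w z) \<in> kernel_span"

lemma kernel_span_Fock: "g \<in> kernel_span \<Longrightarrow> g \<in> Fock"
  by (induction rule: kernel_span.induct) (auto intro: Fock_zero Fock_add[OF _ Fock_cmult[OF fock_kernel_Fock]])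

lemma kernel_span_add:
  assumes "h \<in> kernel_span" "g \<in> kernel_span"
  shows "(\<lambda>z. h z + g z) \<in> kernel_span"
  using assms(2)
proof (induction rule: kernel_span.induct)
  case (step g a w)
  then show ?case using kernel_span.step[OF step(2), of a w] by (simp add: add.assoc)
qed (use assms in simp)

lemma kernel_span_cmult:
  assumes "g \<in> kernel_span" shows "(\<lambda>z. c * g z) \<in> kernel_span"
  using assms
proof (induction rule: kernel_span.induct)
  case (step g a w)
  then show ?case using kernel_span.step[OF step(2), of "c * a" w] by (simp add: algebra_simps)
qed (use kernel_span.zero in simp)

text \<open>Near-optimal approximants are Cauchy by the parallelogram law, and their errors
  tend to zero pointwise since no multiple of a kernel improves them; Fatou's lemma then
  replaces the completeness of the Fock space.\<close>

lemma kernel_span_dense: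
  fixes f :: "complex^'n \<Rightarrow> complex"
  assumes f: "f \<in> Fock" and e: "e > 0"
  shows "\<exists>g\<in>kernel_span. fock_norm (\<lambda>z. f z - g z) < e"
proof -
  define X where "X = (\<lambda>g. (fock_norm (\<lambda>z. f z - g z))\<^sup>2) ` kernel_span"
  define D where "D = Inf X"
  have X: "X \<noteq> {}" "bdd_below X"
    unfolding X_def using kernel_span.zero by (auto intro!: bdd_belowI[of _ 0])
  have D: "D \<le> (fock_norm (\<lambda>z. f z - g z))\<^sup>2" if "g \<in> kernel_span" for g
    unfolding D_def by (rule cInf_lower[OF _ X(2)]) (use that in \<open>auto simp: X_def\<close>)
  have "\<exists>g\<in>kernel_span. (fock_norm (\<lambda>z. f z - g z))\<^sup>2 < D + 1 / real (Suc n)" for n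
  proof -
    have "\<exists>x\<in>X. x < D + 1 / real (Suc n)"
      by (rule cInf_lessD[OF X(1)]) (simp add: D_def)
    then show ?thesis by (auto simp: X_def)
  qed
  then obtain g where g: "\<And>n. g n \<in> kernel_span"
    and gD: "\<And>n. (fock_norm (\<lambda>z. f z - g n z))\<^sup>2 < D + 1 / real (Suc n)"
    by metis
  define u where "u n z = f z - g n z" for n z
  have uF: "u n \<in> Fock" for n
    using Fock_diff[OF f kernel_span_Fock[OF g[of n]]] by (simp add: u_def[abs_def])
  have uD: "(fock_norm (u n))\<^sup>2 < D + 1 / real (Suc n)" for n
    using gD[of n] by (simp add: u_def[abs_def])
  have pt: "(cmod (u n w))\<^sup>2 \<le> exp ((norm w)\<^sup>2) * (1 / real (Suc n))" for n w
  proof -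
    define \<kappa> where "\<kappa> = exp ((norm w)\<^sup>2)"
    have \<kappa>: "\<kappa> > 0" by (simp add: \<kappa>_def)
    \<comment> \<open>The coefficient of the orthogonal projection of \<open>u n\<close> onto the
      kernel at \<open>w\<close>, whose squared norm is \<open>\<kappa>\<close>.\<close>
    define a where "a = u n w / of_real \<kappa>"
    have "D \<le> (fock_norm (\<lambda>z. f z - (g n z + a * fock_kernel w z)))\<^sup>2"
      by (rule D[OF kernel_span.step[OF g]])
    also have "\<dots> = (fock_norm (\<lambda>z. u n z - a * fock_kernel w z))\<^sup>2"
      by (simp add: u_def algebra_simps)
    also have "\<dots> = (fock_norm (u n))\<^sup>2 - 2 * Re (cnj a * u n w) + (cmod a)\<^sup>2 * \<kappa>"
      by (subst fock_norm_diff_square)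
        (auto simp: uF Fock_cmult fock_kernel_Fock fock_inner_cmult_right fock_reproducing fock_norm_cmult
          power_mult_distrib fock_norm_kernel \<kappa>_def)
    also have "cnj a * u n w = of_real ((cmod (u n w))\<^sup>2 / \<kappa>)"
      using complex_norm_square[of "u n w"] by (simp add: a_def mult.commute)
    also have "(cmod a)\<^sup>2 * \<kappa> = (cmod (u n w))\<^sup>2 / \<kappa>"
      using \<kappa> by (simp add: a_def norm_divide power_divide) (simp add: power2_eq_square)
    finally have "(cmod (u n w))\<^sup>2 / \<kappa> \<le> 1 / real (Suc n)"
      using uD[of n] by (simp del: of_nat_Suc)
    then show ?thesis using \<kappa> by (simp add: \<kappa>_def[symmetric] pos_divide_le_eq mult.commute del: of_nat_Suc)
  qed
  have lim0: "(\<lambda>n. u n w) \<longlonglongrightarrow> 0" for w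
  proof -
    have "(\<lambda>n. exp ((norm w)\<^sup>2) * (1 / real (Suc n))) \<longlonglongrightarrow> exp ((norm w)\<^sup>2) * 0"
      by (intro tendsto_mult tendsto_const lim_1_over_n[THEN LIMSEQ_Suc])
    then have z: "(\<lambda>n. exp ((norm w)\<^sup>2) * (1 / real (Suc n))) \<longlonglongrightarrow> 0" by simp
    have "(\<lambda>n. (cmod (u n w))\<^sup>2) \<longlonglongrightarrow> 0"
    proof (rule tendsto_sandwich[OF _ _ tendsto_const z])
      show "\<forall>\<^sub>F n in sequentially. 0 \<le> (cmod (u n w))\<^sup>2" by simp
      show "\<forall>\<^sub>F n in sequentially. (cmod (u n w))\<^sup>2 \<le> exp ((norm w)\<^sup>2) * (1 / real (Suc n))"
        by (rule always_eventually[OF allI[OF pt]])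
    qed
    from tendsto_real_sqrt[OF this] show ?thesis
      by (simp add: tendsto_norm_zero_iff)
  qed
  have cauchy: "(fock_norm (\<lambda>z. u n z - u m z))\<^sup>2 \<le> 4 / real (Suc n)" if "n \<le> m" for n m
  proof -
    \<comment> \<open>The midpoint of two approximants is again a candidate, which bounds the norm
      of \<open>u n + u m\<close> from below as the parallelogram law requires.\<close>
    have "(\<lambda>z. (1/2) * (g n z + g m z)) \<in> kernel_span"
      by (intro kernel_span_cmult kernel_span_add g)
    from D[OF this] have "D \<le> (fock_norm (\<lambda>z. (1/2) * (u n z + u m z)))\<^sup>2"
      by (simp add: u_def[abs_def] algebra_simps)
    also have "\<dots> = (fock_norm (\<lambda>z. u n z + u m z))\<^sup>2 / 4"
      by (subst fock_norm_cmult) (simp add: power_mult_distrib power2_eq_square)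
    finally have "4 * D \<le> (fock_norm (\<lambda>z. u n z + u m z))\<^sup>2" by simp
    moreover have "1 / real (Suc m) \<le> 1 / real (Suc n)"
      using that by (intro divide_left_mono) auto
    moreover have "4 / real (Suc n) = 4 * (1 / real (Suc n))" by simp
    ultimately show ?thesis
      using fock_parallelogram[OF uF[of n] uF[of m]] uD[of n] uD[of m] by linarith
  qed
  have small: "fock_norm (u n) \<le> sqrt (4 / real (Suc n))" for n
  \<comment> \<open>\<open>n\<close> stays fixed while the second index tends to infinity. The shift
    to \<open>m + n\<close> puts every term in the range of the Cauchy estimate.\<close>
  proof (rule fock_norm_Fatou[of "\<lambda>m z. u n z - u (m + n) z"])
    show "(\<lambda>m. u n z - u (m + n) z) \<longlonglongrightarrow> u n z" for z
      using tendsto_diff[OF tendsto_const[of "u n z"] LIMSEQ_ignore_initial_segment[OF lim0[of z], of n]] by simp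
    show "fock_norm (\<lambda>z. u n z - u (m + n) z) \<le> sqrt (4 / real (Suc n))" for m
      using cauchy[of n "m + n"] by (intro real_le_rsqrt) simp
  qed (auto intro: Fock_diff uF)
  have "(\<lambda>n. sqrt (4 * (1 / real (Suc n)))) \<longlonglongrightarrow> sqrt (4 * 0)"
    by (intro tendsto_real_sqrt tendsto_mult tendsto_const lim_1_over_n[THEN LIMSEQ_Suc])
  then have "\<forall>\<^sub>F n in sequentially. sqrt (4 * (1 / real (Suc n))) < e"
    using e by (intro order_tendstoD) auto
  then obtain n where "sqrt (4 * (1 / real (Suc n))) < e"
    by (auto simp: eventually_sequentially)
  then have "fock_norm (u n) < e" using small[of n] by simp
  then show ?thesis using g[of n] by (auto simp: u_def[abs_def])
qed

section \<open>Weak convergence, holomorphic dependence and separation\<close>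

text \<open>Pointwise convergence is convergence against kernels; the common norm bound carries it
  from their dense span to every \<open>k\<close>.\<close>

lemma fock_weak_convergence:
  assumes u: "\<And>n. u n \<in> Fock" and f: "f \<in> Fock" and k: "k \<in> Fock"
    and lim: "\<And>z. (\<lambda>n. u n z) \<longlonglongrightarrow> f z" and le: "\<And>n. fock_norm (u n) \<le> C"
  shows "(\<lambda>n. fock_inner (u n) k) \<longlonglongrightarrow> fock_inner f k"
proof -
  define v where "v n z = u n z - f z" for n z
  have vF: "v n \<in> Fock" for n
    using Fock_diff[OF u f] by (simp add: v_def[abs_def])
  define C' where "C' = C + fock_norm f"
  have vC: "fock_norm (v n) \<le> C'" for n
    using fock_norm_triangle_diff[OF u[of n] f] le[of n] by (simp add: v_def[abs_def] C'_def)
  have C': "0 \<le> C'" using vC[of 0] fock_norm_nonneg order_trans by blast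
  have v0: "(\<lambda>n. v n z) \<longlonglongrightarrow> 0" for z
    using tendsto_diff[OF lim[of z] tendsto_const[of "f z"]] by (simp add: v_def)
  have span: "(\<lambda>n. fock_inner (v n) g) \<longlonglongrightarrow> 0" if "g \<in> kernel_span" for g
    using that
  proof (induction rule: kernel_span.induct)
    case zero
    show ?case by (simp add: fock_inner_def)
  next
    case (step g a w)
    have "fock_inner (v n) (\<lambda>z. g z + a * fock_kernel w z) = fock_inner (v n) g + cnj a * v n w" for n
      by (simp add: fock_inner_add_right vF kernel_span_Fock[OF step(1)] Fock_cmult fock_kernel_Fock
          fock_inner_cmult_right fock_reproducing)
    then show ?case
      using tendsto_add[OF step(2) tendsto_mult[OF tendsto_const[of "cnj a"] v0[of w]]] by simp
  qed
  have "(\<lambda>n. fock_inner (v n) k) \<longlonglongrightarrow> 0"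
  proof (rule LIMSEQ_I)
    fix e :: real assume e: "e > 0"
    \<comment> \<open>Chosen so that \<open>C' * d\<close> is at most \<open>e / 2\<close>; the
      added 1 keeps the denominator positive when \<open>C'\<close> is zero.\<close>
    define d where "d = e / (2 * (C' + 1))"
    have d: "d > 0" using e C' by (simp add: d_def)
    have Cd: "C' * d \<le> e / 2" using e C' by (simp add: d_def field_simps)
    obtain g where g: "g \<in> kernel_span" "fock_norm (\<lambda>z. k z - g z) < d"
      using kernel_span_dense[OF k d] by blast
    obtain N where N: "\<And>n. n \<ge> N \<Longrightarrow> norm (fock_inner (v n) g - 0) < e / 2"
      using LIMSEQ_D[OF span[OF g(1)], of "e/2"] e by auto
    show "\<exists>no. \<forall>n\<ge>no. norm (fock_inner (v n) k - 0) < e"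
    proof (intro exI allI impI)
      fix n assume "n \<ge> N"
      have "fock_inner (v n) k = fock_inner (v n) g + fock_inner (v n) (\<lambda>z. k z - g z)"
        by (simp add: fock_inner_diff_right vF k kernel_span_Fock[OF g(1)])
      then have "norm (fock_inner (v n) k) \<le> norm (fock_inner (v n) g) + norm (fock_inner (v n) (\<lambda>z. k z - g z))"
        by (simp add: norm_triangle_ineq)
      also have "norm (fock_inner (v n) (\<lambda>z. k z - g z)) \<le> fock_norm (v n) * fock_norm (\<lambda>z. k z - g z)"
        by (rule fock_Cauchy_Schwarz[OF vF Fock_diff[OF k kernel_span_Fock[OF g(1)]]])
      also have "\<dots> \<le> C' * d" using g(2) vC[of n] C' by (intro mult_mono) auto
      finally show "norm (fock_inner (v n) k - 0) < e" using N[OF \<open>n \<ge> N\<close>] Cd by simp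
    qed
  qed
  moreover have "fock_inner (u n) k = fock_inner (v n) k + fock_inner f k" for n
    by (simp add: v_def[abs_def] fock_inner_diff_left u f k)
  ultimately show ?thesis
    using tendsto_add[OF _ tendsto_const[of "fock_inner f k"], of "\<lambda>n. fock_inner (v n) k" 0] by simp
qed

text \<open>Against a kernel the pairing is \<open>u r w\<close>, holomorphic by assumption. For
  general \<open>k\<close> it is a uniform limit on \<open>S\<close> of pairings with elements of
  the kernel span.\<close>

lemma fock_inner_holomorphic:
  assumes S: "open S" and u: "\<And>r. r \<in> S \<Longrightarrow> u r \<in> Fock" and le: "\<And>r. r \<in> S \<Longrightarrow> fock_norm (u r) \<le> C"
    and hol: "\<And>z. (\<lambda>r. u r z) holomorphic_on S" and k: "k \<in> Fock"
  shows "(\<lambda>r. fock_inner (u r) k) holomorphic_on S"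
proof -
  have span: "(\<lambda>r. fock_inner (u r) g) holomorphic_on S" if "g \<in> kernel_span" for g
    using that
  proof (induction rule: kernel_span.induct)
    case zero
    show ?case by (simp add: fock_inner_def)
  next
    case (step g a w)
    have "fock_inner (u r) (\<lambda>z. g z + a * fock_kernel w z) = fock_inner (u r) g + cnj a * u r w" if "r \<in> S" for r
      by (simp add: fock_inner_add_right u that kernel_span_Fock[OF step(1)] Fock_cmult fock_kernel_Fock
          fock_inner_cmult_right fock_reproducing)
    moreover have "(\<lambda>r. fock_inner (u r) g + cnj a * u r w) holomorphic_on S"
      by (intro holomorphic_intros step hol)
    ultimately show ?case by (simp cong: holomorphic_cong)
  qed
  have "\<exists>g\<in>kernel_span. fock_norm (\<lambda>z. k z - g z) < 1 / real (Suc n)" for n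
    by (rule kernel_span_dense[OF k]) simp
  then obtain g where g: "\<And>n. g n \<in> kernel_span"
    and gk: "\<And>n. fock_norm (\<lambda>z. k z - g n z) < 1 / real (Suc n)"
    by metis
  have dist: "dist (fock_inner (u r) (g n)) (fock_inner (u r) k) \<le> \<bar>C\<bar> * (1 / real (Suc n))" if "r \<in> S" for r n
  proof -
    have "dist (fock_inner (u r) (g n)) (fock_inner (u r) k) = cmod (fock_inner (u r) (\<lambda>z. k z - g n z))"
      by (simp add: fock_inner_diff_right u that k kernel_span_Fock[OF g] dist_norm norm_minus_commute)
    also have "\<dots> \<le> fock_norm (u r) * fock_norm (\<lambda>z. k z - g n z)"
      by (rule fock_Cauchy_Schwarz[OF u[OF that] Fock_diff[OF k kernel_span_Fock[OF g]]])
    also have "\<dots> \<le> \<bar>C\<bar> * (1 / real (Suc n))"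
      using le[OF that] gk[of n] by (intro mult_mono) auto
    finally show ?thesis .
  qed
  have unif: "uniform_limit S (\<lambda>n r. fock_inner (u r) (g n)) (\<lambda>r. fock_inner (u r) k) sequentially"
    unfolding uniform_limit_iff
  proof (intro allI impI)
    fix e :: real assume "e > 0"
    have "(\<lambda>n. \<bar>C\<bar> * (1 / real (Suc n))) \<longlonglongrightarrow> \<bar>C\<bar> * 0"
      by (intro tendsto_mult tendsto_const lim_1_over_n[THEN LIMSEQ_Suc])
    then have "\<forall>\<^sub>F n in sequentially. \<bar>C\<bar> * (1 / real (Suc n)) < e"
      using \<open>e > 0\<close> by (intro order_tendstoD) auto
    then show "\<forall>\<^sub>F n in sequentially. \<forall>x\<in>S. dist (fock_inner (u x) (g n)) (fock_inner (u x) k) < e"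
      by (rule eventually_mono) (use dist order_le_less_trans in blast)
  qed
  show ?thesis
  proof (rule holomorphic_uniform_sequence[OF S])
    show "(\<lambda>r. fock_inner (u r) (g n)) holomorphic_on S" for n by (rule span[OF g])
    show "\<exists>d>0. cball x d \<subseteq> S \<and> uniform_limit (cball x d) (\<lambda>n r. fock_inner (u r) (g n)) (\<lambda>r. fock_inner (u r) k) sequentially"
      if "x \<in> S" for x
      using open_contains_cball[of S] S that uniform_limit_on_subset[OF unif] by blast
  qed
qed

text \<open>Gives uniqueness of the vector representing an adjoint.\<close>

lemma fock_inner_separates:
  assumes h: "h \<in> Fock" "h' \<in> Fock" and dense: "\<And>f e. f \<in> Fock \<Longrightarrow> e > 0 \<Longrightarrow> \<exists>g\<in>X. fock_norm (\<lambda>z. f z - g z) < e"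
    and X: "X \<subseteq> Fock" and eq: "\<And>g. g \<in> X \<Longrightarrow> fock_inner g h = fock_inner g h'"
  shows "h = h'"
proof -
  define k where "k z = h z - h' z" for z
  have k: "k \<in> Fock" using Fock_diff[OF h] by (simp add: k_def[abs_def])
  have "fock_norm k = 0"
  proof (rule ccontr)
    assume "fock_norm k \<noteq> 0"
    then have pos: "fock_norm k > 0" using fock_norm_nonneg[of k] by linarith
    \<comment> \<open>Approximating \<open>k\<close> to within its own norm suffices:
      \<open>g\<close> is orthogonal to \<open>k\<close>, so the squared norm of \<open>k\<close>
      would be strictly smaller than itself.\<close>
    then obtain g where g: "g \<in> X" "fock_norm (\<lambda>z. k z - g z) < fock_norm k"
      using dense[OF k] by blast
    then have gF: "g \<in> Fock" using X by blast
    have "fock_inner g k = 0"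
      using eq[OF g(1)] by (simp add: k_def[abs_def] fock_inner_diff_right gF h)
    then have "fock_inner k k = fock_inner (\<lambda>z. k z - g z) k"
      by (simp add: fock_inner_diff_left gF k)
    then have "(fock_norm k)\<^sup>2 = cmod (fock_inner (\<lambda>z. k z - g z) k)"
      by (metis abs_power2 fock_inner_self_norm norm_of_real)
    also have "\<dots> \<le> fock_norm (\<lambda>z. k z - g z) * fock_norm k"
      by (rule fock_Cauchy_Schwarz[OF Fock_diff[OF k gF] k])
    also have "\<dots> < fock_norm k * fock_norm k"
      using g(2) pos by simp
    finally show False by (simp add: power2_eq_square)
  qed
  from fock_norm_eq_0[OF k this] show ?thesis
    by (auto simp: k_def fun_eq_iff)
qed

section \<open>Dilations and affine weighted composition operators\<close>

text \<open>Contraction towards \<open>p\<close>, weighted by the exponential that appears when a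
  multiplier \<open>exp (cinner z l)\<close> is moved past it. The parameter is complex to allow
  analytic continuation; at \<open>r = 1\<close> the result is \<open>g\<close>.\<close>

definition fock_dilation ::
    "complex^'n \<Rightarrow> complex^'n \<Rightarrow> (complex^'n \<Rightarrow> complex) \<Rightarrow> complex \<Rightarrow> complex^'n \<Rightarrow> complex" where
  "fock_dilation l p g r z = exp ((1 - r) * cinner z l) * g (r *s z + (1 - r) *s p)"

lemma exp_cmult_cinner: "exp (a * cinner z l) = exp (cinner z (cnj a *s l))"
  by (simp add: cinner_scale_right)

lemma entire_fock_dilation: "entire g \<Longrightarrow> entire (fock_dilation l p g r)"
  unfolding fock_dilation_def[abs_def] exp_cmult_cinner
  by (intro entire_mult entire_exp_cinner entire_scaled)

lemma fock_pointwise_le: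
  assumes "f \<in> Fock" "fock_norm f \<le> C" "norm w \<le> R"
  shows "cmod (f w) \<le> C * exp (R\<^sup>2 / 2)"
proof -
  have "cmod (f w) \<le> fock_norm f * exp ((norm w)\<^sup>2 / 2)" by (rule fock_pointwise[OF assms(1)])
  also have "\<dots> \<le> C * exp (R\<^sup>2 / 2)"
    using assms(2) power_mono[OF assms(3) norm_ge_zero, of 2] order_trans[OF fock_norm_nonneg[of f] assms(2)]
    by (intro mult_mono) auto
  finally show ?thesis .
qed

text \<open>Shrinking the argument turns the growth allowed in the Fock space into growth with rate
  \<open>\<rho> < 1\<close>, to which \<open>Fock_growth\<close> applies, uniformly in
  \<open>g\<close> and \<open>r\<close>.\<close>

lemma fock_dilation_bound:
  assumes \<rho>: "0 \<le> \<rho>" "\<rho> < (1::real)" and C: "0 \<le> C"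
  obtains N where "\<And>g r. g \<in> Fock \<Longrightarrow> fock_norm g \<le> C \<Longrightarrow> cmod r \<le> \<rho> \<Longrightarrow>
     fock_dilation l p g r \<in> Fock \<and> fock_norm (fock_dilation l p g r) \<le> N"
proof -
  obtain N where N: "\<And>u :: complex^'a \<Rightarrow> complex. entire u \<Longrightarrow>
      (\<And>z. cmod (u z) \<le> C * exp (2 * norm l * norm z + (\<rho> * norm z + 2 * norm p)\<^sup>2 / 2)) \<Longrightarrow>
      u \<in> Fock \<and> fock_norm u \<le> N"
    using Fock_growth[OF \<rho> C, of "2 * norm l" "2 * norm p"] by blast
  show thesis
  proof (rule that, rule N)
    fix g :: "complex^'a \<Rightarrow> complex" and r assume g: "g \<in> Fock" "fock_norm g \<le> C" and r: "cmod r \<le> \<rho>"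
    show "entire (fock_dilation l p g r)" by (rule entire_fock_dilation[OF FockD(1)[OF g(1)]])
    fix z
    have r1: "cmod (1 - r) \<le> 2" using norm_triangle_ineq4[of 1 r] r \<rho> by simp
    have "cmod (exp ((1 - r) * cinner z l)) \<le> exp (cmod ((1 - r) * cinner z l))"
      by (rule norm_exp)
    also have "\<dots> \<le> exp (2 * norm l * norm z)"
      using mult_mono[OF r1 norm_cinner_le[of z l]] by (simp add: norm_mult mult_ac)
    finally have 1: "cmod (exp ((1 - r) * cinner z l)) \<le> exp (2 * norm l * norm z)" .
    have "norm (r *s z + (1 - r) *s p) \<le> cmod r * norm z + cmod (1 - r) * norm p"
      using norm_triangle_ineq[of "r *s z" "(1 - r) *s p"] by (simp only: norm_scale)
    also have "\<dots> \<le> \<rho> * norm z + 2 * norm p"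
      by (intro add_mono mult_right_mono r r1) auto
    finally have "cmod (g (r *s z + (1 - r) *s p)) \<le> C * exp ((\<rho> * norm z + 2 * norm p)\<^sup>2 / 2)"
      by (rule fock_pointwise_le[OF g])
    then have "cmod (fock_dilation l p g r z) \<le> exp (2 * norm l * norm z) * (C * exp ((\<rho> * norm z + 2 * norm p)\<^sup>2 / 2))"
      unfolding fock_dilation_def norm_mult by (intro mult_mono 1) auto
    then show "cmod (fock_dilation l p g r z) \<le> C * exp (2 * norm l * norm z + (\<rho> * norm z + 2 * norm p)\<^sup>2 / 2)"
      by (simp add: exp_add mult_ac)
  qed
qed

lemma fock_dilation_Fock:
  assumes "g \<in> Fock" "cmod r < 1" shows "fock_dilation l p g r \<in> Fock"
proof -
  obtain N where "\<And>g s. g \<in> Fock \<Longrightarrow> fock_norm g \<le> fock_norm (g :: complex^'a \<Rightarrow> complex) \<Longrightarrow> cmod s \<le> cmod r \<Longrightarrow>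
     fock_dilation l p g s \<in> Fock"
    using fock_dilation_bound[of "cmod r" _ l p] assms(2) fock_norm_nonneg norm_ge_zero by (metis order_refl)
  then show ?thesis using assms(1) by blast
qed

text \<open>For fixed \<open>z\<close> the argument of \<open>g\<close> runs along a complex line as
  \<open>r\<close> varies.\<close>

lemma fock_dilation_holomorphic:
  assumes "entire g" shows "(\<lambda>r. fock_dilation l p g r z) holomorphic_on S"
proof -
  have "r *s z + (1 - r) *s p = r *s (z - p) + p" for r
    by (simp add: vec_eq_iff algebra_simps)
  then show ?thesis
    unfolding fock_dilation_def by (simp only:) (intro holomorphic_intros entire_line_holomorphic[OF assms])
qed

text \<open>The available bound is uniform only on smaller discs, so holomorphy is checked at each
  \<open>x\<close> inside a disc of radius \<open>\<rho>\<close> between \<open>cmod x\<close> and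
  1.\<close>

lemma fock_inner_dilation_holomorphic:
  assumes g: "g \<in> Fock" and k: "k \<in> Fock"
  shows "(\<lambda>r. fock_inner (fock_dilation l p g r) k) holomorphic_on ball 0 1"
  unfolding holomorphic_on_def
proof
  fix x :: complex assume "x \<in> ball 0 1"
  then obtain \<rho> where \<rho>: "cmod x < \<rho>" "\<rho> < 1" using dense[of "cmod x" 1] by auto
  have \<rho>0: "0 \<le> \<rho>" using \<rho>(1) norm_ge_zero[of x] by linarith
  obtain N where N: "\<And>g' r. g' \<in> Fock \<Longrightarrow> fock_norm g' \<le> fock_norm g \<Longrightarrow> cmod r \<le> \<rho> \<Longrightarrow>
     fock_dilation l p g' r \<in> Fock \<and> fock_norm (fock_dilation l p g' r) \<le> N"
    using fock_dilation_bound[OF \<rho>0 \<rho>(2) fock_norm_nonneg[of g], of l p] by blast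
  have "(\<lambda>r. fock_inner (fock_dilation l p g r) k) holomorphic_on ball 0 \<rho>"
    by (rule fock_inner_holomorphic[OF open_ball _ _ _ k, where C = N])
      (use N[OF g order_refl] fock_dilation_holomorphic[OF FockD(1)[OF g]] in auto)
  then show "(\<lambda>r. fock_inner (fock_dilation l p g r) k) field_differentiable at x within ball 0 1"
    using field_differentiable_at_within holomorphic_on_imp_differentiable_at[OF _ open_ball, of _ 0 \<rho> x] \<rho>(1)
    by (simp add: field_differentiable_at_within)
qed

text \<open>The bound on discs need not survive \<open>r\<close> tending to 1, so real parameters
  are treated by changing variables. Convexity of the squared norm supplies the decay that pays for
  the exponential weight.\<close>

lemma fock_dilation_real_bound:
  fixes g :: "complex^'n \<Rightarrow> complex"
  assumes g: "g \<in> Fock" and r: "1/2 \<le> r" "r < 1"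
  shows "fock_norm (fock_dilation l p g (of_real r)) \<le> sqrt (exp ((norm l)\<^sup>2 + (norm p)\<^sup>2) * 2 ^ DIM(complex^'n)) * fock_norm g"
proof -
  let ?d = "fock_dilation l p g (of_real r)"
  let ?D = "2 ^ DIM(complex^'n) :: real"
  define K where "K = exp ((norm l)\<^sup>2 + (norm p)\<^sup>2)"
  have K: "0 < K" by (simp add: K_def)
  define H where "H u = (cmod (g u))\<^sup>2 * exp (- (norm u)\<^sup>2)" for u
  have H0: "0 \<le> H u" for u by (simp add: H_def)
  have iH: "integrable lborel H" using FockD(2)[OF g] by (simp add: H_def[abs_def])
  have r0: "r \<noteq> 0" using r by simp
  define t where "t = of_real (1 - r) *s p"
  have arg: "of_real r *s z + (1 - of_real r) *s p = t + r *\<^sub>R z" for z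
    by (simp add: t_def vec_eq_iff scaleR_conv_of_real[where 'a=complex])
  have iHr: "integrable lborel (\<lambda>z. H (t + r *\<^sub>R z))"
    using iH borel_measurable_integrable[OF iH] by (subst integrable_lborel_affine_iff[OF r0]) auto
  have d: "?d \<in> Fock" by (rule fock_dilation_Fock[OF g]) (use r in auto)
  have le: "(cmod (?d z))\<^sup>2 * exp (- (norm z)\<^sup>2) \<le> K * H (t + r *\<^sub>R z)" for z
  proof -
    define s where "s = 1 - r"
    have s: "0 < s" "s \<le> 1" using r by (auto simp: s_def)
    define x where "x = norm z"
    have x0: "0 \<le> x" by (simp add: x_def)
    have "norm (t + r *\<^sub>R z) \<le> s * norm p + r * x"
      using norm_triangle_ineq[of t "r *\<^sub>R z"] r unfolding t_def norm_scale norm_of_real by (simp add: s_def x_def)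
    then have "(norm (t + r *\<^sub>R z))\<^sup>2 \<le> (s * norm p + r * x)\<^sup>2" by (intro power_mono) auto
    \<comment> \<open>The exact defect in the convexity inequality for the square, with weights
      \<open>s\<close> and \<open>r\<close> summing to 1.\<close>
    also have "\<dots> = s * (norm p)\<^sup>2 + r * x\<^sup>2 - s * r * (norm p - x)\<^sup>2"
      by (simp add: s_def power2_eq_square algebra_simps)
    also have "\<dots> \<le> s * (norm p)\<^sup>2 + r * x\<^sup>2" using s r by simp
    finally have 1: "(norm (t + r *\<^sub>R z))\<^sup>2 \<le> s * (norm p)\<^sup>2 + r * x\<^sup>2" .
    have "Re (cinner z l) \<le> x * norm l"
      using complex_Re_le_cmod[of "cinner z l"] norm_cinner_le[of z l] by (simp add: x_def)
    then have "s * (2 * Re (cinner z l)) \<le> s * (x\<^sup>2 + (norm l)\<^sup>2)"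
      using s sum_squares_bound[of x "norm l"] by (intro mult_left_mono) auto
    \<comment> \<open>The terms in \<open>x\<^sup>2\<close> add up to \<open>s - 1 + r = 0\<close>,
      so the remaining bound does not depend on \<open>z\<close>.\<close>
    then have "2 * (s * Re (cinner z l)) - x\<^sup>2 + (norm (t + r *\<^sub>R z))\<^sup>2 \<le> s * (norm p)\<^sup>2 + s * (norm l)\<^sup>2"
      using 1 by (simp add: s_def algebra_simps)
    also have "\<dots> \<le> 1 * (norm p)\<^sup>2 + 1 * (norm l)\<^sup>2"
      using s by (intro add_mono mult_right_mono) auto
    finally have "exp (2 * (s * Re (cinner z l)) - x\<^sup>2) \<le> exp ((norm l)\<^sup>2 + (norm p)\<^sup>2 - (norm (t + r *\<^sub>R z))\<^sup>2)"
      by simp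
    then have e: "(exp (s * Re (cinner z l)))\<^sup>2 * exp (- x\<^sup>2) \<le> K * exp (- (norm (t + r *\<^sub>R z))\<^sup>2)"
      by (simp add: K_def exp_double[symmetric] exp_add[symmetric])
    have "(cmod (?d z))\<^sup>2 * exp (- (norm z)\<^sup>2) = ((exp (s * Re (cinner z l)))\<^sup>2 * exp (- x\<^sup>2)) * (cmod (g (t + r *\<^sub>R z)))\<^sup>2"
      unfolding fock_dilation_def arg by (simp add: norm_mult power_mult_distrib s_def x_def)
    also have "\<dots> \<le> (K * exp (- (norm (t + r *\<^sub>R z))\<^sup>2)) * (cmod (g (t + r *\<^sub>R z)))\<^sup>2"
      by (intro mult_right_mono e) auto
    finally show ?thesis by (simp add: H_def mult_ac)
  qed
  have I: "(\<integral>z. H z \<partial>lborel) = r ^ DIM(complex^'n) * (\<integral>z. H (t + r *\<^sub>R z) \<partial>lborel)"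
    using integral_lborel_affine[OF r0, of H t] borel_measurable_integrable[OF iH] r by simp
  have I0: "0 \<le> (\<integral>z. H (t + r *\<^sub>R z) \<partial>lborel)" by (simp add: H0)
  \<comment> \<open>The Jacobian of the contraction is controlled because \<open>r\<close> is at
    least one half.\<close>
  have "1 \<le> ?D * r ^ DIM(complex^'n)"
    unfolding power_mult_distrib[symmetric] using r by (intro one_le_power) auto
  then have "1 * (\<integral>z. H (t + r *\<^sub>R z) \<partial>lborel) \<le> (?D * r ^ DIM(complex^'n)) * (\<integral>z. H (t + r *\<^sub>R z) \<partial>lborel)"
    using I0 by (rule mult_right_mono)
  then have I2: "(\<integral>z. H (t + r *\<^sub>R z) \<partial>lborel) \<le> ?D * (\<integral>z. H z \<partial>lborel)"
    unfolding I by (simp only: mult.assoc mult_1_left)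
  have "(\<integral>z. (cmod (?d z))\<^sup>2 * exp (- (norm z)\<^sup>2) \<partial>lborel) \<le> (\<integral>z. K * H (t + r *\<^sub>R z) \<partial>lborel)"
    by (intro integral_mono FockD(2)[OF d] integrable_mult_right iHr le)
  also have "\<dots> \<le> K * (?D * (\<integral>z. H z \<partial>lborel))"
    using I2 K by simp
  finally have "(\<integral>z. (cmod (?d z))\<^sup>2 * exp (- (norm z)\<^sup>2) \<partial>lborel) / pi ^ CARD('n)
      \<le> K * (?D * (\<integral>z. H z \<partial>lborel)) / pi ^ CARD('n)"
    by (rule divide_right_mono) simp
  then have "(fock_norm ?d)\<^sup>2 \<le> K * ?D * (fock_norm g)\<^sup>2"
    unfolding fock_norm_square H_def by (simp only: mult.assoc times_divide_eq_right)
  then have "fock_norm ?d \<le> sqrt (K * ?D * (fock_norm g)\<^sup>2)"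
    by (rule real_le_rsqrt)
  then show ?thesis by (simp only: real_sqrt_mult K_def real_sqrt_abs abs_of_nonneg fock_norm_nonneg)
qed

text \<open>Weak convergence along one sequence of real parameters suffices for the limit at
  1.\<close>

lemma fock_dilation_weak:
  assumes g: "g \<in> Fock" and k: "k \<in> Fock"
  shows "(\<lambda>n. fock_inner (fock_dilation l p g (of_real (1 - 1 / real (n + 2)))) k) \<longlonglongrightarrow> fock_inner g k"
proof (rule fock_weak_convergence[OF _ g k])
  fix n :: nat
  \<comment> \<open>The offset 2 starts the sequence at one half, where the uniform bound
    begins.\<close>
  have r: "1/2 \<le> 1 - 1 / real (n + 2)" "1 - 1 / real (n + 2) < 1" by (auto simp: field_simps)
  then show "fock_dilation l p g (of_real (1 - 1 / real (n + 2))) \<in> Fock"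
    by (intro fock_dilation_Fock[OF g]) (auto simp del: of_real_diff)
  show "fock_norm (fock_dilation l p g (of_real (1 - 1 / real (n + 2))))
    \<le> sqrt (exp ((norm l)\<^sup>2 + (norm p)\<^sup>2) * 2 ^ DIM(complex^'a)) * fock_norm g"
    by (rule fock_dilation_real_bound[OF g r])
next
  fix z
  have "(\<lambda>n. 1 - 1 / real (n + 2)) \<longlonglongrightarrow> 1 - 0"
    by (intro tendsto_diff tendsto_const LIMSEQ_ignore_initial_segment[OF lim_1_over_n])
  then have lim: "(\<lambda>n. of_real (1 - 1 / real (n + 2)) :: complex) \<longlonglongrightarrow> of_real 1"
    by (intro tendsto_of_real) simp
  have "continuous_on UNIV (\<lambda>r. fock_dilation l p g r z)"
    by (rule holomorphic_on_imp_continuous_on[OF fock_dilation_holomorphic[OF FockD(1)[OF g]]])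
  then have "(\<lambda>n. fock_dilation l p g (of_real (1 - 1 / real (n + 2))) z) \<longlonglongrightarrow> fock_dilation l p g (of_real 1) z"
    by (rule continuous_on_tendsto_compose[OF _ lim]) auto
  then show "(\<lambda>n. fock_dilation l p g (of_real (1 - 1 / real (n + 2))) z) \<longlonglongrightarrow> g z"
    by (simp add: fock_dilation_def)
qed

section \<open>Weighted composition operators with affine symbols\<close>

abbreviation affine_wcomp ::
    "complex \<Rightarrow> complex^'n \<Rightarrow> complex^'n^'n \<Rightarrow> complex^'n \<Rightarrow> (complex^'n \<Rightarrow> complex) \<Rightarrow> complex^'n \<Rightarrow> complex" where
  "affine_wcomp \<theta> l Q q \<equiv> wcomp (\<lambda>z. \<theta> * exp (cinner z l)) (\<lambda>z. Q *v z + q)"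

text \<open>Moving \<open>Q\<close> to the other side of the form leaves an exponential in
  \<open>z\<close> and a scalar. The kernel span is therefore invariant, which later yields a dense
  domain.\<close>

lemma affine_wcomp_kernel:
  "affine_wcomp \<theta> l Q q (fock_kernel w) = (\<lambda>z. \<theta> * exp (cinner q w) * fock_kernel (l + cadjoint Q *v w) z)"
  by (rule ext) (simp add: wcomp_def fock_kernel_def cinner_add_left cinner_add_right cinner_mult_left exp_add mult_ac)

lemma affine_wcomp_kernel_span:
  assumes "g \<in> kernel_span" shows "affine_wcomp \<theta> l Q q g \<in> kernel_span"
  using assms
proof (induction rule: kernel_span.induct)
  case zero
  then show ?case using kernel_span.zero by (simp add: wcomp_def)
next
  case (step g a w)
  have "affine_wcomp \<theta> l Q q (\<lambda>z. g z + a * fock_kernel w z)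
      = (\<lambda>z. affine_wcomp \<theta> l Q q g z + (a * (\<theta> * exp (cinner q w))) * fock_kernel (l + cadjoint Q *v w) z)"
  proof
    fix z
    have "affine_wcomp \<theta> l Q q (\<lambda>z. g z + a * fock_kernel w z) z
        = affine_wcomp \<theta> l Q q g z + a * affine_wcomp \<theta> l Q q (fock_kernel w) z"
      by (simp add: wcomp_def algebra_simps)
    then show "affine_wcomp \<theta> l Q q (\<lambda>z. g z + a * fock_kernel w z) z
        = affine_wcomp \<theta> l Q q g z + (a * (\<theta> * exp (cinner q w))) * fock_kernel (l + cadjoint Q *v w) z"
      unfolding affine_wcomp_kernel by (simp only: mult.assoc)
  qed
  then show ?case by (simp only: kernel_span.step[OF step(2)])
qed

lemma fock_dilation_kernel_span:
  assumes "g \<in> kernel_span" shows "fock_dilation 0 p g r \<in> kernel_span"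
  using assms
proof (induction rule: kernel_span.induct)
  case zero
  then show ?case using kernel_span.zero by (simp add: fock_dilation_def[abs_def])
next
  case (step g a w)
  have "fock_dilation 0 p (\<lambda>z. g z + a * fock_kernel w z) r
      = (\<lambda>z. fock_dilation 0 p g r z + (a * exp ((1 - r) * cinner p w)) * fock_kernel (cnj r *s w) z)"
    by (rule ext) (simp add: fock_dilation_def fock_kernel_def cinner_add_left cinner_scale_left cinner_scale_right exp_add[symmetric] cinner_diff_left algebra_simps)
  then show ?case by (simp only: kernel_span.step[OF step(2)])
qed

text \<open>Contracting \<open>Q *v z + q\<close> towards \<open>q\<close> is the same as evaluating
  the affine map at \<open>r *s z\<close>. The part of the multiplier not absorbed by this is the
  weight \<open>exp ((1 - r) * cinner z l)\<close>.\<close>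

lemma affine_wcomp_dilation:
  "affine_wcomp \<theta> l Q q (fock_dilation 0 q h r) = fock_dilation l 0 (affine_wcomp \<theta> l Q q h) r"
proof
  fix z
  have "r *s (Q *v z + q) + (1 - r) *s q = Q *v (r *s z) + q"
    by (simp add: mult_scale vec_eq_iff algebra_simps)
  moreover have "exp (cinner z l) = exp ((1 - r) * cinner z l) * exp (cinner (r *s z) l)"
    by (simp add: cinner_scale_left algebra_simps flip: exp_add)
  ultimately show "affine_wcomp \<theta> l Q q (fock_dilation 0 q h r) z = fock_dilation l 0 (affine_wcomp \<theta> l Q q h) r z"
    by (simp add: wcomp_def fock_dilation_def mult_ac)
qed

lemma affine_wcomp_kernel_span_inner:
  assumes k: "k \<in> Fock" and k': "k' \<in> Fock"
    and ker: "\<And>w. fock_inner (affine_wcomp \<theta> l Q q (fock_kernel w)) k = fock_inner (fock_kernel w) k'"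
    and g: "g \<in> kernel_span"
  shows "fock_inner (affine_wcomp \<theta> l Q q g) k = fock_inner g k'"
  using g
proof (induction rule: kernel_span.induct)
  case zero
  show ?case by (simp add: wcomp_def fock_inner_def)
next
  case (step g a w)
  have K: "affine_wcomp \<theta> l Q q (fock_kernel w) \<in> Fock"
    unfolding affine_wcomp_kernel by (intro Fock_cmult fock_kernel_Fock)
  have "affine_wcomp \<theta> l Q q (\<lambda>z. g z + a * fock_kernel w z)
      = (\<lambda>z. affine_wcomp \<theta> l Q q g z + a * affine_wcomp \<theta> l Q q (fock_kernel w) z)"
    by (auto simp: wcomp_def distrib_left mult_ac)
  then have "fock_inner (affine_wcomp \<theta> l Q q (\<lambda>z. g z + a * fock_kernel w z)) k
      = fock_inner (affine_wcomp \<theta> l Q q g) k + a * fock_inner (affine_wcomp \<theta> l Q q (fock_kernel w)) k"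
    using kernel_span_Fock[OF affine_wcomp_kernel_span[OF step(1)]] K
    by (simp add: fock_inner_add_left Fock_cmult k fock_inner_cmult_left)
  then show ?case
    by (simp add: step(2) ker fock_inner_add_left kernel_span_Fock[OF step(1)] Fock_cmult fock_kernel_Fock k' fock_inner_cmult_left)
qed

text \<open>The dilations about \<open>q\<close> and about \<open>0\<close> are intertwined by the operator. For small
  parameters the composite with the operator is bounded, so that the kernel functions decide;
  the identity then continues analytically to the unit disc and passes to the limit at \<open>1\<close>.\<close>

lemma affine_wcomp_adjoint_kernel_core:
  fixes k k' h :: "complex^'n \<Rightarrow> complex"
  assumes k: "k \<in> Fock" and k': "k' \<in> Fock"
    and ker: "\<And>w. fock_inner (affine_wcomp \<theta> l Q q (fock_kernel w)) k = fock_inner (fock_kernel w) k'"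
    and h: "h \<in> Fock" and Th: "affine_wcomp \<theta> l Q q h \<in> Fock"
  shows "fock_inner (affine_wcomp \<theta> l Q q h) k = fock_inner h k'"
proof -
  let ?T = "affine_wcomp \<theta> l Q q"
  define F where "F r = fock_inner (fock_dilation l 0 (?T h) r) k" for r
  define G where "G r = fock_inner (fock_dilation 0 q h r) k'" for r
  obtain B where B: "B > 0" "\<And>z. norm (Q *v z) \<le> B * norm z"
    using linear_bounded_pos[OF linear_cmult_vec[of Q]] by auto
  \<comment> \<open>For \<open>cmod r \<le> \<delta>\<close> the vector \<open>r *s (Q *v z)\<close>
    has norm at most half that of \<open>z\<close>, whatever the size of \<open>Q\<close>.\<close>
  define \<delta> where "\<delta> = 1 / (2 * (B + 1))"
  have \<delta>: "0 < \<delta>" "\<delta> < 1" "\<delta> * B \<le> 1/2" using B(1) by (auto simp: \<delta>_def field_simps)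
  have small: "F r = G r" if r: "cmod r \<le> \<delta>" for r
  proof -
    have "\<exists>g\<in>kernel_span. fock_norm (\<lambda>z. h z - g z) < 1 / real (Suc n)" for n
      by (rule kernel_span_dense[OF h]) simp
    then obtain g where g: "\<And>n. g n \<in> kernel_span"
      and gh: "\<And>n. fock_norm (\<lambda>z. h z - g n z) < 1 / real (Suc n)"
      by metis
    define C where "C = fock_norm h + 1"
    have C: "0 \<le> C" by (simp add: C_def)
    have gF: "g n \<in> Fock" for n by (rule kernel_span_Fock[OF g])
    have gC: "fock_norm (g n) \<le> C" for n
    proof -
      \<comment> \<open>\<open>g n\<close> is written as a difference because the triangle
        inequality is available in that form.\<close>
      have "fock_norm (\<lambda>z. h z - (h z - g n z)) \<le> fock_norm h + fock_norm (\<lambda>z. h z - g n z)"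
        by (rule fock_norm_triangle_diff[OF h Fock_diff[OF h gF]])
      moreover have "1 / real (Suc n) \<le> 1" by simp
      ultimately have "fock_norm (\<lambda>z. h z - (h z - g n z)) \<le> C" using gh[of n] unfolding C_def by linarith
      then show ?thesis by simp
    qed
    have glim: "(\<lambda>n. g n z) \<longlonglongrightarrow> h z" for z
    proof (rule LIM_zero_cancel, rule Lim_null_comparison)
      have "cmod (g n z - h z) \<le> 1 / real (Suc n) * exp ((norm z)\<^sup>2 / 2)" for n
        using fock_pointwise_le[OF Fock_diff[OF h gF] less_imp_le[OF gh[of n]] order_refl, of z]
        by (simp add: norm_minus_commute)
      then show "\<forall>\<^sub>F n in sequentially. cmod (g n z - h z) \<le> 1 / real (Suc n) * exp ((norm z)\<^sup>2 / 2)"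
        by simp
      have "(\<lambda>n. 1 / real (Suc n) * exp ((norm z)\<^sup>2 / 2)) \<longlonglongrightarrow> 0 * exp ((norm z)\<^sup>2 / 2)"
        by (intro tendsto_mult tendsto_const lim_1_over_n[THEN LIMSEQ_Suc])
      then show "(\<lambda>n. 1 / real (Suc n) * exp ((norm z)\<^sup>2 / 2)) \<longlonglongrightarrow> 0" by simp
    qed
    obtain N where N: "\<And>g s. g \<in> Fock \<Longrightarrow> fock_norm g \<le> C \<Longrightarrow> cmod s \<le> \<delta> \<Longrightarrow>
      fock_dilation 0 q g s \<in> Fock \<and> fock_norm (fock_dilation 0 q g s) \<le> N"
      using fock_dilation_bound[OF less_imp_le[OF \<delta>(1)] \<delta>(2) C, of 0 q] by blast
    have hC: "fock_norm h \<le> C" by (simp add: C_def)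
    have limG: "(\<lambda>n. fock_inner (fock_dilation 0 q (g n) r) k') \<longlonglongrightarrow> G r"
      unfolding G_def
    proof (rule fock_weak_convergence[OF _ _ k'])
      show "(\<lambda>n. fock_dilation 0 q (g n) r z) \<longlonglongrightarrow> fock_dilation 0 q h r z" for z
        unfolding fock_dilation_def by (intro tendsto_intros glim)
    qed (use N[OF gF gC r] N[OF h hC r] in auto)
    obtain M where M: "\<And>u :: complex^'n \<Rightarrow> complex. entire u \<Longrightarrow>
      (\<And>z. cmod (u z) \<le> (cmod \<theta> * C) * exp (norm l * norm z + (1/2 * norm z + norm q)\<^sup>2 / 2)) \<Longrightarrow>
      u \<in> Fock \<and> fock_norm u \<le> M"
      using Fock_growth[of "1/2" "cmod \<theta> * C" "norm l" "norm q"] C by auto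
    \<comment> \<open>Boundedness of the composite: since \<open>q\<close> is the centre, the
      argument of \<open>f\<close> is \<open>r *s (Q *v z) + q\<close>, so growth rate one half
      applies.\<close>
    have bd: "?T (fock_dilation 0 q f r) \<in> Fock \<and> fock_norm (?T (fock_dilation 0 q f r)) \<le> M"
      if f: "f \<in> Fock" "fock_norm f \<le> C" for f
    proof (rule M)
      show "entire (?T (fock_dilation 0 q f r))"
        unfolding wcomp_def
        by (intro entire_mult entire_const entire_exp_cinner entire_affine entire_fock_dilation FockD(1)[OF f(1)])
      fix z
      have eq: "?T (fock_dilation 0 q f r) z = \<theta> * exp (cinner z l) * f (r *s (Q *v z) + q)"
        by (simp add: wcomp_def fock_dilation_def vec_eq_iff algebra_simps vector_add_ldistrib)
      have "norm (r *s (Q *v z) + q) \<le> cmod r * norm (Q *v z) + norm q"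
        using norm_triangle_ineq[of "r *s (Q *v z)" q] by (simp only: norm_scale)
      also have "cmod r * norm (Q *v z) \<le> \<delta> * (B * norm z)"
        by (intro mult_mono r B(2)) (use \<delta> in auto)
      also have "\<dots> \<le> 1/2 * norm z"
        using mult_right_mono[OF \<delta>(3), of "norm z"] by (simp add: mult.assoc)
      finally have "cmod (f (r *s (Q *v z) + q)) \<le> C * exp ((1/2 * norm z + norm q)\<^sup>2 / 2)"
        by (intro fock_pointwise_le[OF f]) simp
      then have "cmod (?T (fock_dilation 0 q f r) z) \<le> cmod \<theta> * exp (norm z * norm l) * (C * exp ((1/2 * norm z + norm q)\<^sup>2 / 2))"
        unfolding eq norm_mult by (intro mult_mono order_refl cmod_exp_cinner_le) auto
      then show "cmod (?T (fock_dilation 0 q f r) z) \<le> (cmod \<theta> * C) * exp (norm l * norm z + (1/2 * norm z + norm q)\<^sup>2 / 2)"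
        by (simp add: exp_add mult_ac)
    qed
    have limF: "(\<lambda>n. fock_inner (?T (fock_dilation 0 q (g n) r)) k) \<longlonglongrightarrow> F r"
      \<comment> \<open>Intertwining rewrites \<open>F r\<close> as the operator applied to a
        dilation of \<open>h\<close>, which can be approximated through \<open>g n\<close>.\<close>
      unfolding F_def affine_wcomp_dilation[symmetric]
    proof (rule fock_weak_convergence[OF _ _ k])
      show "(\<lambda>n. ?T (fock_dilation 0 q (g n) r) z) \<longlonglongrightarrow> ?T (fock_dilation 0 q h r) z" for z
        unfolding fock_dilation_def wcomp_def by (intro tendsto_intros glim)
    qed (use bd[OF gF gC] bd[OF h hC] in auto)
    have "fock_inner (?T (fock_dilation 0 q (g n) r)) k = fock_inner (fock_dilation 0 q (g n) r) k'" for n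
      by (rule affine_wcomp_kernel_span_inner[OF k k' ker fock_dilation_kernel_span[OF g]])
    then show "F r = G r" using LIMSEQ_unique[OF limF] limG by simp
  qed
  have hol: "(\<lambda>r. F r - G r) holomorphic_on ball 0 1"
    unfolding F_def G_def
    by (intro holomorphic_intros fock_inner_dilation_holomorphic Th h k k')
  have all: "F r - G r = 0" if "cmod r < 1" for r
  proof (rule analytic_continuation[OF hol open_ball connected_ball, of "ball 0 \<delta>" 0])
    \<comment> \<open>The zeros on the small disc accumulate at its centre, so the identity theorem
      covers the unit disc.\<close>
    show "(0::complex) islimpt ball 0 \<delta>" using \<delta> by (simp add: islimpt_ball)
  qed (use \<delta> small that in auto)
  have "(\<lambda>n. F (of_real (1 - 1 / real (n + 2)))) \<longlonglongrightarrow> fock_inner (?T h) k"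
    unfolding F_def by (rule fock_dilation_weak[OF Th k])
  moreover have "(\<lambda>n. G (of_real (1 - 1 / real (n + 2)))) \<longlonglongrightarrow> fock_inner h k'"
    unfolding G_def by (rule fock_dilation_weak[OF h k'])
  moreover have "F (of_real (1 - 1 / real (n + 2))) = G (of_real (1 - 1 / real (n + 2)))" for n
    using all[of "of_real (1 - 1 / real (n + 2))"] by (simp del: of_real_diff)
  ultimately show ?thesis using LIMSEQ_unique by simp
qed

section \<open>Adjoints and selfadjointness with respect to the conjugation\<close>

lemma map_leD: "T \<subseteq>\<^sub>m S \<Longrightarrow> T f = Some g \<Longrightarrow> S f = Some g"
  unfolding map_le_def by (metis domI)

lemma densely_definedD:
  assumes "densely_defined S"
  shows "dom S \<subseteq> Fock" "f \<in> Fock \<Longrightarrow> e > 0 \<Longrightarrow> \<exists>g\<in>dom S. fock_norm (\<lambda>z. f z - g z) < e"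
  using assms by (auto simp: densely_defined_def fun_diff_def)

text \<open>Density of the domain makes the representing vector unique, which resolves the definite
  description.\<close>

lemma op_adjoint_eqI:
  assumes S: "densely_defined S" and g: "g \<in> Fock" and h: "h \<in> Fock"
    and eq: "\<And>f. f \<in> dom S \<Longrightarrow> fock_inner (the (S f)) g = fock_inner f h"
  shows "op_adjoint S g = Some h"
proof -
  have "(THE h. h \<in> Fock \<and> (\<forall>f\<in>dom S. fock_inner (the (S f)) g = fock_inner f h)) = h"
  proof (rule the_equality)
    fix h' assume h': "h' \<in> Fock \<and> (\<forall>f\<in>dom S. fock_inner (the (S f)) g = fock_inner f h')"
    show "h' = h"
      by (rule fock_inner_separates[OF _ h densely_definedD(2)[OF S] densely_definedD(1)[OF S]])
        (use h' eq in auto)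
  qed (use h eq in auto)
  then show ?thesis using g h eq by (auto simp: op_adjoint_def)
qed

lemma op_adjointD:
  assumes S: "densely_defined S" and "op_adjoint S g = Some h"
  shows "g \<in> Fock" "h \<in> Fock" "f \<in> dom S \<Longrightarrow> fock_inner (the (S f)) g = fock_inner f h"
proof -
  from assms(2) obtain h' where h': "g \<in> Fock" "h' \<in> Fock"
      "\<And>f. f \<in> dom S \<Longrightarrow> fock_inner (the (S f)) g = fock_inner f h'"
    unfolding op_adjoint_def by (auto split: if_splits)
  have "h = h'" using op_adjoint_eqI[OF S h'] assms(2) by simp
  with h' show "g \<in> Fock" "h \<in> Fock" "f \<in> dom S \<Longrightarrow> fock_inner (the (S f)) g = fock_inner f h" by auto
qed

text \<open>A restriction imposes fewer test vectors, while density of its own domain still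
  determines the value.\<close>

lemma op_adjoint_antimono:
  assumes "T \<subseteq>\<^sub>m S" "densely_defined S" "densely_defined T" "op_adjoint S g = Some h"
  shows "op_adjoint T g = Some h"
proof (rule op_adjoint_eqI[OF assms(3)])
  show "g \<in> Fock" "h \<in> Fock" using op_adjointD[OF assms(2,4)] by auto
  fix f assume "f \<in> dom T"
  then have "S f = T f" "f \<in> dom S" using assms(1) map_leD[OF assms(1)] by fastforce+
  then show "fock_inner (the (T f)) g = fock_inner f h"
    using op_adjointD(3)[OF assms(2,4), of f] by simp
qed

section \<open>The maximal weighted composition operator\<close>

lemma wco_max_eq_Some: "wco_max \<psi> \<phi> f = Some g \<longleftrightarrow> f \<in> Fock \<and> wcomp \<psi> \<phi> f \<in> Fock \<and> g = wcomp \<psi> \<phi> f"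
  by (auto simp: wco_max_def)

lemma dom_wco_max: "dom (wco_max \<psi> \<phi>) = {f \<in> Fock. wcomp \<psi> \<phi> f \<in> Fock}"
  by (auto simp: wco_max_def dom_def)

text \<open>Pairing with the kernel at \<open>w\<close> evaluates the image at \<open>w\<close>, and
  this is \<open>\<psi> w\<close> times evaluation of \<open>f\<close> at \<open>\<phi> w\<close>.
  The formula holds for every densely defined restriction.\<close>

lemma op_adjoint_wcomp_kernel:
  assumes T: "densely_defined T" "T \<subseteq>\<^sub>m wco_max \<psi> \<phi>"
  shows "op_adjoint T (fock_kernel w) = Some (\<lambda>z. cnj (\<psi> w) * fock_kernel (\<phi> w) z)"
proof (rule op_adjoint_eqI[OF T(1) fock_kernel_Fock Fock_cmult[OF fock_kernel_Fock]])
  fix f assume f: "f \<in> dom T"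
  then obtain g where g: "T f = Some g" by auto
  then have "f \<in> Fock" "wcomp \<psi> \<phi> f \<in> Fock" "the (T f) = wcomp \<psi> \<phi> f"
    using map_leD[OF T(2), OF g] by (auto simp: wco_max_eq_Some)
  then show "fock_inner (the (T f)) (fock_kernel w) = fock_inner f (\<lambda>z. cnj (\<psi> w) * fock_kernel (\<phi> w) z)"
    by (simp add: fock_inner_cmult_right fock_reproducing) (simp add: wcomp_def)
qed

text \<open>Norm limits are pointwise limits, so \<open>g\<close> must be
  \<open>wcomp \<psi> \<phi> f\<close>; as \<open>g\<close> lies in the Fock space, \<open>f\<close>
  lies in the maximal domain.\<close>

lemma closed_op_wco_max: "closed_op (wco_max \<psi> \<phi>)"
  unfolding closed_op_def
proof (intro conjI allI impI)
  show "dom (wco_max \<psi> \<phi>) \<subseteq> Fock" by (auto simp: dom_wco_max)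
  show "ran (wco_max \<psi> \<phi>) \<subseteq> Fock" by (auto simp: ran_def wco_max_eq_Some)
  fix u f g
  assume A: "(\<forall>k. u k \<in> dom (wco_max \<psi> \<phi>)) \<and> f \<in> Fock \<and> g \<in> Fock \<and>
       (\<lambda>k. fock_norm (u k - f)) \<longlonglongrightarrow> 0 \<and> (\<lambda>k. fock_norm (the (wco_max \<psi> \<phi> (u k)) - g)) \<longlonglongrightarrow> 0"
  have uF: "u k \<in> Fock" "wcomp \<psi> \<phi> (u k) \<in> Fock" for k using A by (auto simp: dom_wco_max)
  have the: "the (wco_max \<psi> \<phi> (u k)) = wcomp \<psi> \<phi> (u k)" for k using uF by (simp add: wco_max_def)
  have pw: "(\<lambda>k. v k z) \<longlonglongrightarrow> h z"
    if "\<And>k. v k \<in> Fock" "h \<in> Fock" "(\<lambda>k. fock_norm (v k - h)) \<longlonglongrightarrow> 0" for v h and z :: "complex^'a"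
  proof (rule LIM_zero_cancel, rule Lim_null_comparison)
    show "\<forall>\<^sub>F k in sequentially. norm (v k z - h z) \<le> fock_norm (v k - h) * exp ((norm z)\<^sup>2 / 2)"
      using fock_pointwise[OF Fock_diff[OF that(1,2)], of _ z] by (simp add: fun_diff_def)
    show "(\<lambda>k. fock_norm (v k - h) * exp ((norm z)\<^sup>2 / 2)) \<longlonglongrightarrow> 0"
      using tendsto_mult[OF that(3) tendsto_const] by simp
  qed
  have "wcomp \<psi> \<phi> f z = g z" for z
  proof (rule LIMSEQ_unique)
    show "(\<lambda>k. wcomp \<psi> \<phi> (u k) z) \<longlonglongrightarrow> g z"
      by (rule pw) (use A uF in \<open>auto simp: the\<close>)
    show "(\<lambda>k. wcomp \<psi> \<phi> (u k) z) \<longlonglongrightarrow> wcomp \<psi> \<phi> f z"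
      unfolding wcomp_def by (intro tendsto_mult tendsto_const pw) (use A uF in auto)
  qed
  then have "wcomp \<psi> \<phi> f = g" by auto
  then show "wco_max \<psi> \<phi> f = Some g" using A by (simp add: wco_max_def)
qed

section \<open>The conjugation\<close>

lemma matrix_inv_works:
  assumes "invertible (A :: 'a::semiring_1^'n^'m)"
  shows "A ** matrix_inv A = mat 1" "matrix_inv A ** A = mat 1"
  using someI_ex[OF assms[unfolded invertible_def]] by (auto simp: matrix_inv_def)

lemma mult_vec_minus: "M *v (- x) = - (M *v (x :: complex^'n))"
  by (simp add: matrix_vector_mult_def vec_eq_iff sum_negf)

text \<open>\<open>cinner x (vconj y)\<close> is the bilinear dot product of \<open>x\<close> and
  \<open>y\<close>, hence symmetric. This reading is used throughout below.\<close>

lemma cinner_vconj_commute: "cinner x (vconj y) = cinner y (vconj x)"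
  using cinner_vconj[of "vconj x" y] by simp

text \<open>The conditions on the inverse and the adjoint say that \<open>A\<close> is unitary and
  symmetric.\<close>

locale fock_conjugation =
  fixes A :: "complex^'n^'n" and b :: "complex^'n" and c :: complex
  assumes inv: "invertible A" and A_inv: "matrix_inv A = cadjoint A" and A_sym: "cadjoint A = mconj A"
    and Ab: "A *v vconj b + b = 0"
    and c: "(cmod c)\<^sup>2 * exp ((norm b)\<^sup>2) = 1"
begin

abbreviation C :: "(complex^'n \<Rightarrow> complex) \<Rightarrow> complex^'n \<Rightarrow> complex" where
  "C \<equiv> conjABc A b c"

text \<open>The antiholomorphic affine involution of the underlying space that induces the
  conjugation.\<close>

definition \<sigma> :: "complex^'n \<Rightarrow> complex^'n" where
  "\<sigma> z = vconj (A *v z + b)"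

lemma A_mult_adjoint: "A *v (cadjoint A *v x) = x" "cadjoint A *v (A *v x) = x"
  using matrix_inv_works[OF inv] by (simp_all add: A_inv matrix_vector_mul_assoc)

lemma A_vconj: "A *v vconj x = vconj (cadjoint A *v x)"
  by (simp only: A_sym vconj_mult[of "mconj A"]) (simp add: mconj_def)

lemma cadjoint_vconj: "cadjoint A *v vconj x = vconj (A *v x)"
  by (simp add: A_sym vconj_mult)

lemma adjoint_b: "cadjoint A *v b = - vconj b"
proof -
  have "vconj (cadjoint A *v b) = - b"
    using Ab by (simp only: A_vconj[symmetric] eq_neg_iff_add_eq_0)
  then have "vconj (vconj (cadjoint A *v b)) = vconj (- b)" by simp
  then show ?thesis by (simp add: vconj_minus)
qed

lemma A_vconj_b: "A *v vconj b = - b"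
  using Ab by (simp add: eq_neg_iff_add_eq_0)

text \<open>Symmetry of \<open>A\<close> with respect to the bilinear dot product.\<close>

lemma cinner_A: "cinner (A *v x) (vconj y) = cinner x (vconj (A *v y))"
  by (simp add: cinner_mult_left cadjoint_vconj)

lemma \<sigma>_\<sigma>: "\<sigma> (\<sigma> z) = z"
  by (simp add: \<sigma>_def A_vconj matrix_vector_right_distrib A_mult_adjoint adjoint_b vconj_add vconj_minus)

lemma cinner_\<sigma>_right: "cinner x (\<sigma> w) = cinner x (vconj (A *v w)) + cinner x (vconj b)"
  by (simp add: \<sigma>_def vconj_add cinner_add_right)

lemma cnj_cinner_\<sigma>: "cnj (cinner (\<sigma> z) w) = cinner z (vconj (A *v w)) + cinner b (vconj w)"
proof -
  have "cnj (cinner (\<sigma> z) w) = cinner (A *v z + b) (vconj w)"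
    unfolding cnj_cinner \<sigma>_def using cinner_vconj[of "vconj w" "A *v z + b"] by simp
  then show ?thesis by (simp add: cinner_add_left cinner_A)
qed

lemma conj_apply: "C f z = c * exp (cinner z (vconj b)) * cnj (f (\<sigma> z))"
  by (simp add: conjABc_def \<sigma>_def)

text \<open>The exponents picked up at \<open>z\<close> and at \<open>\<sigma> z\<close> add up to
  the squared norm of \<open>b\<close>, which the normalisation of \<open>c\<close> cancels.\<close>

lemma conj_involutive: "C (C f) = f"
proof
  fix z
  have "cnj (cinner (\<sigma> z) (vconj b)) = - cinner z (vconj b) + of_real ((norm b)\<^sup>2)"
    by (simp only: cnj_cinner_\<sigma> A_vconj_b vconj_minus cinner_minus vconj_vconj cinner_self)
  then have "exp (cinner z (vconj b)) * cnj (exp (cinner (\<sigma> z) (vconj b))) = of_real (exp ((norm b)\<^sup>2))"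
    unfolding exp_cnj exp_add[symmetric] by (simp only: exp_of_real[symmetric]) simp
  then have "C (C f) z = (c * cnj c) * of_real (exp ((norm b)\<^sup>2)) * f z"
    by (simp add: conj_apply \<sigma>_\<sigma> mult_ac)
  also have "\<dots> = of_real ((cmod c)\<^sup>2 * exp ((norm b)\<^sup>2)) * f z"
    by (simp only: complex_norm_square[symmetric] of_real_mult)
  finally show "C (C f) z = f z" by (simp only: c of_real_1 mult_1)
qed

lemma conj_kernel: "C (fock_kernel w) = (\<lambda>z. (c * exp (cinner b (vconj w))) * fock_kernel (\<sigma> w) z)"
  by (rule ext)
    (simp add: conj_apply fock_kernel_def exp_cnj cnj_cinner_\<sigma> cinner_\<sigma>_right exp_add)

lemma conj_cmult: "C (\<lambda>z. a * f z) = (\<lambda>z. cnj a * C f z)"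
  by (rule ext) (simp add: conj_apply)

lemma norm_A: "norm (A *v x) = norm x"
proof -
  have "complex_of_real ((norm (A *v x))\<^sup>2) = of_real ((norm x)\<^sup>2)"
    unfolding cinner_self[symmetric] cinner_mult_left by (simp only: A_mult_adjoint)
  then have "(norm (A *v x))\<^sup>2 = (norm x)\<^sup>2" by (simp only: of_real_eq_iff)
  then show ?thesis by simp
qed

lemma norm_\<sigma>_square: "(norm (\<sigma> z))\<^sup>2 = (norm z)\<^sup>2 + (norm b)\<^sup>2 - 2 * Re (cinner z (vconj b))"
proof -
  have "(norm (\<sigma> z))\<^sup>2 = (A *v z + b) \<bullet> (A *v z + b)"
    by (simp add: \<sigma>_def power2_norm_eq_inner)
  also have "\<dots> = (norm (A *v z))\<^sup>2 + (norm b)\<^sup>2 + 2 * Re (cinner (A *v z) b)"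
    by (simp add: inner_add_left inner_add_right power2_norm_eq_inner Re_cinner inner_commute)
  also have "cinner (A *v z) b = - cinner z (vconj b)"
    by (simp add: cinner_mult_left adjoint_b)
  finally show ?thesis by (simp add: norm_A)
qed

text \<open>The factor in front has exactly the modulus that converts the Gaussian at
  \<open>z\<close> into the Gaussian at \<open>\<sigma> z\<close>. As \<open>\<sigma>\<close> is a
  real-linear isometry followed by a translation, integrability is preserved.\<close>

lemma conj_Fock:
  assumes f: "f \<in> Fock" shows "C f \<in> Fock"
proof -
  have ent: "entire (C f)"
    unfolding conj_apply[abs_def] \<sigma>_def
    by (intro entire_mult entire_const entire_exp_cinner entire_conj_affine FockD(1)[OF f])
  define H where "H u = (cmod (f u))\<^sup>2 * exp (- (norm u)\<^sup>2)" for u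
  have "integrable lborel H" using FockD(2)[OF f] by (simp add: H_def[abs_def])
  then have iH: "integrable lborel (\<lambda>y. H (vconj b + 1 *\<^sub>R y))"
    by (subst integrable_lborel_affine_iff) (auto dest: borel_measurable_integrable)
  have lin: "linear (\<lambda>z. vconj (A *v z))"
    using linear_compose[OF linear_cmult_vec linear_vconj] by (simp add: o_def)
  have m: "(\<lambda>z. vconj (A *v z)) \<in> borel \<rightarrow>\<^sub>M borel"
    using lin by (intro borel_measurable_continuous_onI linear_continuous_on) (simp add: linear_conv_bounded_linear)
  have "distr lborel borel (\<lambda>z. vconj (A *v z)) = lborel"
    by (rule distr_lborel_isometry[OF lin]) (simp add: norm_A)
  then have "integrable (distr lborel borel (\<lambda>z. vconj (A *v z))) (\<lambda>y. H (vconj b + 1 *\<^sub>R y))"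
    using iH by simp
  then have "integrable lborel (\<lambda>z. H (vconj b + 1 *\<^sub>R vconj (A *v z)))"
    using m borel_measurable_integrable[OF iH] by (subst (asm) integrable_distr_eq) auto
  then have int: "integrable lborel (\<lambda>z. H (\<sigma> z))"
    by (simp add: \<sigma>_def vconj_add add.commute)
  have "(cmod (C f z))\<^sup>2 * exp (- (norm z)\<^sup>2) = H (\<sigma> z)" for z
  proof -
    have c': "(cmod c)\<^sup>2 = exp (- (norm b)\<^sup>2)"
      using c by (simp add: exp_minus field_simps)
    have "(cmod c * exp (Re (cinner z (vconj b))))\<^sup>2 * exp (- (norm z)\<^sup>2)
        = exp (- (norm b)\<^sup>2 + 2 * Re (cinner z (vconj b)) - (norm z)\<^sup>2)"
      by (simp add: power_mult_distrib c' exp_double[symmetric] exp_add[symmetric])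
    also have "\<dots> = exp (- (norm (\<sigma> z))\<^sup>2)"
      by (simp add: norm_\<sigma>_square)
    finally show ?thesis
      by (simp add: conj_apply H_def norm_mult power_mult_distrib mult_ac)
  qed
  then have "integrable lborel (\<lambda>z. (cmod (C f z))\<^sup>2 * exp (- (norm z)\<^sup>2))"
    using int by simp
  with ent show ?thesis by (simp add: Fock_def)
qed

section \<open>From selfadjointness to the symbols\<close>

text \<open>The image of the conjugated kernel is computed twice: through the adjoint, and directly
  from the weighted composition. Both sides are explicit exponentials.\<close>

lemma symbol_equation:
  assumes T: "T \<subseteq>\<^sub>m wco_max \<psi> \<phi>" and sa: "C_selfadjoint C T"
  shows "\<psi> z * exp (cinner b (vconj w)) * exp (cinner (\<phi> z) (\<sigma> w))
    = \<psi> w * exp (cinner b (vconj (\<phi> w))) * exp (cinner z (\<sigma> (\<phi> w)))"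
proof -
  have d: "densely_defined T"
    and eq: "T = (\<lambda>f. if f \<in> Fock then map_option C (op_adjoint T (C f)) else None)"
    using sa by (auto simp: C_selfadjoint_def)
  have "T (C (fock_kernel w)) = map_option C (op_adjoint T (C (C (fock_kernel w))))"
    using conj_Fock[OF fock_kernel_Fock] by (subst eq) simp
  also have "\<dots> = Some (\<lambda>z. \<psi> w * C (fock_kernel (\<phi> w)) z)"
    by (simp add: conj_involutive op_adjoint_wcomp_kernel[OF d T] conj_cmult)
  finally have Some: "T (C (fock_kernel w)) = Some (\<lambda>z. \<psi> w * C (fock_kernel (\<phi> w)) z)" .
  have "wcomp \<psi> \<phi> (C (fock_kernel w)) = (\<lambda>z. \<psi> w * C (fock_kernel (\<phi> w)) z)"
    using map_leD[OF T, OF Some] by (simp add: wco_max_eq_Some)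
  from fun_cong[OF this, of z]
  have "c * (\<psi> z * exp (cinner b (vconj w)) * exp (cinner (\<phi> z) (\<sigma> w)))
      = c * (\<psi> w * exp (cinner b (vconj (\<phi> w))) * exp (cinner z (\<sigma> (\<phi> w))))"
    by (simp add: wcomp_def conj_kernel mult_ac) (simp add: fock_kernel_def mult_ac)
  moreover have "c \<noteq> 0" using c by auto
  ultimately show ?thesis by simp
qed

lemma normal_form_of_selfadjoint:
  assumes T: "T \<subseteq>\<^sub>m wco_max \<psi> \<phi>" and sa: "C_selfadjoint C T"
    and \<psi>: "\<psi> \<noteq> (\<lambda>_. 0)" and \<phi>: "entire_map \<phi>"
  shows "normal_form A b \<psi> \<phi>"
proof -
  define q where "q = \<phi> 0"
  let ?P = "\<lambda>x y. cinner x (vconj y)"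
  note eq = symbol_equation[OF T sa]
  \<comment> \<open>The case \<open>w = 0\<close>, where \<open>\<sigma> 0\<close> is
    \<open>vconj b\<close>.\<close>
  have eq0: "\<psi> z * exp (?P (\<phi> z) b) = \<psi> 0 * exp (?P b q + ?P z (A *v q) + ?P z b)" for z
    using eq[of z 0] by (simp add: q_def[symmetric] cinner_\<sigma>_right exp_add mult_ac)
  have \<psi>z: "\<psi> z = \<psi> 0 * exp (?P b q + ?P z (A *v q) + ?P z b - ?P (\<phi> z) b)" for z
    using eq0[of z] by (simp add: exp_diff field_simps)
  have \<psi>0: "\<psi> 0 \<noteq> 0"
    using \<psi> \<psi>z by (metis mult_zero_left)
  \<comment> \<open>Substituting the formula for \<open>\<psi>\<close> on both sides leaves the same
    nonzero factor, which is cancelled.\<close>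
  have exps: "exp (?P z (A *v q) + ?P (\<phi> z) (A *v w)) = exp (?P w (A *v q) + ?P z (A *v \<phi> w))" for z w
  proof -
    have l: "\<psi> z * exp (?P b w) * exp (cinner (\<phi> z) (\<sigma> w))
        = \<psi> 0 * exp (?P b q + ?P z b + ?P w b) * exp (?P z (A *v q) + ?P (\<phi> z) (A *v w))"
      unfolding \<psi>z[of z] cinner_\<sigma>_right mult.assoc exp_add[symmetric]
      by (simp add: cinner_vconj_commute[of b w] algebra_simps)
    have r: "\<psi> w * exp (?P b (\<phi> w)) * exp (cinner z (\<sigma> (\<phi> w)))
        = \<psi> 0 * exp (?P b q + ?P z b + ?P w b) * exp (?P w (A *v q) + ?P z (A *v \<phi> w))"
      unfolding \<psi>z[of w] cinner_\<sigma>_right mult.assoc exp_add[symmetric]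
      by (simp add: cinner_vconj_commute[of b "\<phi> w"] algebra_simps)
    have "exp (?P b q + ?P z b + ?P w b) \<noteq> 0" by simp
    then show ?thesis using eq[of z w] \<psi>0 unfolding l r by simp
  qed
  have cont\<phi>: "continuous_on UNIV \<phi>"
  proof -
    have "continuous_on UNIV (\<lambda>z. \<chi> j. \<phi> z $ j)"
      using \<phi> by (intro continuous_on_vec_lambda entire_continuous) (auto simp: entire_map_def)
    then show ?thesis by simp
  qed
  have sym: "?P z (A *v q) + ?P (\<phi> z) (A *v w) = ?P w (A *v q) + ?P z (A *v \<phi> w)" for z w
  proof -
    define E where "E z = ?P z (A *v q) + ?P (\<phi> z) (A *v w) - (?P w (A *v q) + ?P z (A *v \<phi> w))" for z
    have E1: "exp (E z) = 1" for z by (simp add: E_def exp_diff exps)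
    \<comment> \<open>\<open>E\<close> takes values in the integer multiples of
      \<open>2 * pi * \<i>\<close>; distinct values are more than \<open>pi\<close> apart, so
      continuity on a connected space forces constancy.\<close>
    have "E constant_on UNIV"
    proof (rule continuous_discrete_range_constant)
      show "continuous_on UNIV E" unfolding E_def by (intro continuous_intros cont\<phi>)
      show "\<exists>e>0. \<forall>y. y \<in> UNIV \<and> E y \<noteq> E x \<longrightarrow> e \<le> norm (E y - E x)" for x
      proof (intro exI[of _ pi] conjI allI impI)
        fix y assume y: "y \<in> UNIV \<and> E y \<noteq> E x"
        show "pi \<le> norm (E y - E x)"
        proof (rule ccontr)
          assume "\<not> pi \<le> norm (E y - E x)"
          then have "\<bar>Im (E y) - Im (E x)\<bar> < 2 * pi"
            using abs_Im_le_cmod[of "E y - E x"] pi_gt_zero by simp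
          then have "E y = E x" by (rule exp_complex_eqI) (simp add: E1)
          then show False using y by simp
        qed
      qed simp
    qed auto
    then have "E z = E 0" by (metis UNIV_I constant_on_def)
    \<comment> \<open>At \<open>z = 0\<close> the difference is the bilinear product of
      \<open>q\<close> with \<open>A *v w\<close> minus that of \<open>w\<close> with
      \<open>A *v q\<close>, which vanishes because \<open>A\<close> is symmetric.\<close>
    also have "E 0 = 0"
      using cinner_A[of q w] cinner_vconj_commute[of "A *v q" w] by (simp add: E_def q_def[symmetric])
    finally show ?thesis by (simp add: E_def)
  qed
  define g where "g z = \<phi> z - q" for z
  have g: "?P (g z) (A *v w) = ?P z (A *v g w)" for z w
    using sym[of z w] cinner_A[of q w] cinner_vconj_commute[of "A *v q" w]
    by (simp add: g_def cinner_diff_left matrix_vector_mult_diff_distrib vconj_diff cinner_diff_right algebra_simps)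
  \<comment> \<open>Row \<open>i\<close> is the image of the \<open>i\<close>-th unit vector under
    \<open>A *v g\<close>. Moving this map across the dot product in each coordinate proves it
    linear, with matrix \<open>N\<close>.\<close>
  define N :: "complex^'n^'n" where "N = (\<chi> i j. (A *v g (axis i 1)) $ j)"
  have comp: "?P x (axis i 1) = x $ i" for x and i :: 'n
  proof -
    have "?P x (axis i 1) = (\<Sum>j\<in>UNIV. if j = i then x $ j else 0)"
      unfolding cinner_def vconj_def by (rule sum.cong) (auto simp: axis_def)
    then show ?thesis by simp
  qed
  have Ag: "A *v g z = N *v z" for z
  proof -
    have "(A *v g z) $ i = (N *v z) $ i" for i
    proof -
      have "(A *v g z) $ i = ?P z (A *v g (axis i 1))"
        by (simp only: comp[symmetric] cinner_A g)
      also have "\<dots> = (N *v z) $ i"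
        by (simp add: cinner_def vconj_def N_def matrix_vector_mult_def mult.commute)
      finally show ?thesis .
    qed
    then show ?thesis by (simp add: vec_eq_iff)
  qed
  have Nsym: "transpose N = N"
  proof -
    have "(A *v g (axis j 1)) $ i = (A *v g (axis i 1)) $ j" for i j
    proof -
      have "(A *v g (axis j 1)) $ i = ?P (axis j 1) (A *v g (axis i 1))"
        by (simp only: comp[symmetric] cinner_A g)
      also have "\<dots> = ?P (A *v g (axis i 1)) (axis j 1)" by (rule cinner_vconj_commute)
      finally show ?thesis by (simp only: comp)
    qed
    then show ?thesis by (simp add: transpose_def N_def vec_eq_iff)
  qed
  define Q where "Q = cadjoint A ** N"
  have AQ: "A ** Q = N"
    using matrix_inv_works(1)[OF inv] by (simp add: Q_def A_inv matrix_mul_assoc)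
  have \<phi>Q: "\<phi> z = Q *v z + q" for z
  proof -
    have "g z = Q *v z"
      using arg_cong[OF Ag[of z], of "\<lambda>x. cadjoint A *v x"]
      by (simp only: A_mult_adjoint Q_def matrix_vector_mul_assoc[symmetric])
    then show ?thesis by (simp add: g_def algebra_simps)
  qed
  have \<psi>_form: "\<psi> z = \<psi> 0 * exp (cinner z (vconj (A *v q) + vconj b - cadjoint Q *v vconj b))" for z
  proof -
    have "?P b q + ?P z (A *v q) + ?P z b - ?P (\<phi> z) b
        = cinner z (vconj (A *v q) + vconj b - cadjoint Q *v vconj b)"
      by (simp add: \<phi>Q cinner_add_left cinner_add_right cinner_diff_right cinner_mult_left cinner_vconj_commute[of b q])
    then show ?thesis using \<psi>z[of z] by simp
  qed
  show ?thesis
    unfolding normal_form_def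
  proof (intro exI conjI)
    show "transpose (A ** Q) = A ** Q" by (simp only: AQ Nsym)
    show "\<psi> = (\<lambda>z. \<psi> 0 * exp (cinner z (vconj (A *v q) + vconj b - cadjoint Q *v vconj b)))"
      by (rule ext) (rule \<psi>_form)
    show "\<phi> = (\<lambda>z. Q *v z + q)" by (rule ext) (rule \<phi>Q)
  qed
qed

section \<open>From the symbols to selfadjointness\<close>

lemma selfadjoint_of_normal_form:
  assumes nf: "normal_form A b \<psi> \<phi>"
  shows "C_selfadjoint C (wco_max \<psi> \<phi>)"
proof -
  obtain Q q \<theta> where sym: "transpose (A ** Q) = A ** Q"
    and \<psi>: "\<psi> = (\<lambda>z. \<theta> * exp (cinner z (vconj (A *v q) + vconj b - cadjoint Q *v vconj b)))"
    and \<phi>: "\<phi> = (\<lambda>z. Q *v z + q)"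
    using nf by (auto simp: normal_form_def)
  define l where "l = vconj (A *v q) + vconj b - cadjoint Q *v vconj b"
  define W where "W = wcomp \<psi> \<phi>"
  have W: "W = affine_wcomp \<theta> l Q q" by (simp add: W_def \<psi> \<phi> l_def)
  have span: "kernel_span \<subseteq> dom (wco_max \<psi> \<phi>)"
    using kernel_span_Fock affine_wcomp_kernel_span[of _ \<theta> l Q q] by (auto simp: dom_wco_max W_def[symmetric] W)
  have d: "densely_defined (wco_max \<psi> \<phi>)"
    unfolding densely_defined_def fun_diff_def
  proof (intro conjI ballI allI impI)
    show "dom (wco_max \<psi> \<phi>) \<subseteq> Fock" by (auto simp: dom_wco_max)
    show "\<exists>g\<in>dom (wco_max \<psi> \<phi>). fock_norm (\<lambda>z. f z - g z) < e" if "f \<in> Fock" "e > 0" for f e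
      using kernel_span_dense[OF that] span by blast
  qed
  \<comment> \<open>Multiplying the symmetry of \<open>A ** Q\<close> by the inverse of
    \<open>A\<close> on both sides gives
    \<open>Q ** cadjoint A = cadjoint A ** transpose Q\<close>.\<close>
  have Q_conj: "vconj (A *v (cadjoint Q *v w)) = Q *v vconj (A *v w)" for w
  proof -
    have tA: "transpose A = A"
      using A_sym by (simp add: cadjoint_def mconj_def transpose_def vec_eq_iff)
    have "cadjoint A ** (A ** Q) = Q" "(A ** cadjoint A) = mat 1"
      using matrix_inv_works[OF inv] by (simp_all add: A_inv matrix_mul_assoc)
    moreover have "A ** Q = transpose Q ** A"
      using sym by (simp add: matrix_transpose_mul tA)
    ultimately have "Q ** cadjoint A = cadjoint A ** transpose Q"
      by (metis matrix_mul_assoc matrix_mul_rid)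
    moreover have "mconj (cadjoint Q) = transpose Q"
      by (simp add: mconj_def cadjoint_def transpose_def vec_eq_iff)
    ultimately show ?thesis
      unfolding vconj_mult A_sym[symmetric] by (simp only: matrix_vector_mul_assoc)
  qed
  \<comment> \<open>\<open>\<sigma>\<close> carries the action
    \<open>w \<mapsto> l + cadjoint Q *v w\<close> on kernel points to \<open>\<phi>\<close>; this
    is where the prescribed form of \<open>l\<close> enters.\<close>
  have \<sigma>Q: "\<sigma> (l + cadjoint Q *v w) = Q *v \<sigma> w + q" for w
  proof -
    have "A *v vconj (A *v q) = vconj q" by (simp add: A_vconj A_mult_adjoint)
    then have "\<sigma> (l + cadjoint Q *v w)
        = q + vconj (A *v vconj b) - vconj (A *v (cadjoint Q *v vconj b)) + vconj (A *v (cadjoint Q *v w)) + vconj b"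
      by (simp add: \<sigma>_def l_def matrix_vector_right_distrib matrix_vector_mult_diff_distrib vconj_add vconj_diff)
    also have "\<dots> = Q *v vconj b + q + Q *v vconj (A *v w)"
      by (simp add: Q_conj A_vconj_b vconj_minus mult_vec_minus)
    finally show ?thesis by (simp add: \<sigma>_def vconj_add matrix_vector_right_distrib)
  qed
  \<comment> \<open>The matching identity for the scalar factors, with cross terms cancelled by the
    same form of \<open>l\<close>.\<close>
  have exponent: "cinner q w + cnj (cinner (l + cadjoint Q *v w) (vconj b)) = cnj (cinner w (vconj b)) + cinner (\<sigma> w) l" for w
  proof -
    have 1: "cinner (vconj (A *v w)) (vconj (A *v q)) = cinner q w"
      by (simp add: cinner_vconj cinner_mult_left A_mult_adjoint)
    have 2: "cinner (vconj (A *v x)) (vconj b) = - cinner (vconj b) x" for x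
      by (simp add: cinner_vconj cinner_mult_right adjoint_b)
    have "cinner (vconj (A *v w)) (cadjoint Q *v vconj b) = cinner (vconj (A *v (cadjoint Q *v w))) (vconj b)"
      by (simp add: cinner_mult_right Q_conj)
    also have "\<dots> = - cinner (vconj b) (cadjoint Q *v w)" by (rule 2)
    finally have 3: "cinner (vconj (A *v w)) (cadjoint Q *v vconj b) = - cinner (vconj b) (cadjoint Q *v w)" .
    have "cinner (vconj (A *v w)) l = cinner q w - cinner (vconj b) w + cinner (vconj b) (cadjoint Q *v w)"
      by (simp add: l_def cinner_add_right cinner_diff_right 1 2 3)
    then show ?thesis
      by (simp add: cnj_cinner cinner_add_right cinner_add_left \<sigma>_def vconj_add)
  qed
  \<comment> \<open>Stated pointwise, so that it also holds when \<open>W f\<close> is not in the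
    Fock space; the converse domain inclusion relies on this.\<close>
  have ker: "fock_inner (W (fock_kernel w)) (C f) = cnj (C (W f) w)" if f: "f \<in> Fock" for f w
  proof -
    have "fock_inner (W (fock_kernel w)) (C f) = \<theta> * exp (cinner q w) * cnj (C f (l + cadjoint Q *v w))"
      unfolding W affine_wcomp_kernel fock_inner_cmult_left
      by (simp only: fock_reproducing_right[OF conj_Fock[OF f]])
    also have "\<dots> = \<theta> * cnj c * f (Q *v \<sigma> w + q) * (exp (cinner q w) * exp (cnj (cinner (l + cadjoint Q *v w) (vconj b))))"
      by (simp add: conj_apply \<sigma>Q exp_cnj mult_ac)
    also have "\<dots> = \<theta> * cnj c * f (Q *v \<sigma> w + q) * (exp (cnj (cinner w (vconj b))) * exp (cinner (\<sigma> w) l))"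
      by (simp only: exp_add[symmetric] exponent)
    also have "\<dots> = cnj (C (W f) w)"
      by (simp add: conj_apply W wcomp_def exp_cnj mult_ac)
    finally show ?thesis .
  qed
  have dom: "f \<in> dom (wco_max \<psi> \<phi>) \<longleftrightarrow> f \<in> Fock \<and> W f \<in> Fock" for f
    by (simp add: dom_wco_max W_def)
  have the: "the (wco_max \<psi> \<phi> f) = W f" if "f \<in> dom (wco_max \<psi> \<phi>)" for f
    using that by (simp add: dom) (simp add: wco_max_def W_def)
  \<comment> \<open>The adjoint relation is known on kernels; the dilation argument extends it to
    every \<open>h\<close> in the maximal domain.\<close>
  have fwd: "op_adjoint (wco_max \<psi> \<phi>) (C f) = Some (C (W f))" if f: "f \<in> Fock" "W f \<in> Fock" for f
  proof (rule op_adjoint_eqI[OF d conj_Fock[OF f(1)] conj_Fock[OF f(2)]])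
    fix h assume h: "h \<in> dom (wco_max \<psi> \<phi>)"
    then have hF: "h \<in> Fock" "W h \<in> Fock" by (simp_all add: dom)
    have k: "fock_inner (W (fock_kernel w)) (C f) = fock_inner (fock_kernel w) (C (W f))" for w
      by (simp only: ker[OF f(1)] fock_reproducing_right[OF conj_Fock[OF f(2)]])
    have "fock_inner (W h) (C f) = fock_inner h (C (W f))"
      unfolding W
      by (rule affine_wcomp_adjoint_kernel_core[OF conj_Fock[OF f(1)] conj_Fock[OF f(2), unfolded W] k[unfolded W] hF(1) hF(2)[unfolded W]])
    then show "fock_inner (the (wco_max \<psi> \<phi> h)) (C f) = fock_inner h (C (W f))"
      by (simp add: the[OF h])
  qed
  \<comment> \<open>Testing the adjoint on kernels alone identifies \<open>C (W f)\<close> with the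
    Fock function \<open>h\<close>, so \<open>W f = C h\<close> lies in the Fock space.\<close>
  have bwd: "W f \<in> Fock" if f: "f \<in> Fock" and h: "op_adjoint (wco_max \<psi> \<phi>) (C f) = Some h" for f h
  proof -
    have "fock_kernel w \<in> dom (wco_max \<psi> \<phi>)" for w
      using fock_kernel_Fock Fock_cmult by (auto simp: dom W affine_wcomp_kernel)
    from op_adjointD(3)[OF d h this] have "fock_inner (W (fock_kernel w)) (C f) = fock_inner (fock_kernel w) h" for w
      by (simp add: the \<open>\<And>w. fock_kernel w \<in> dom (wco_max \<psi> \<phi>)\<close>)
    then have "cnj (C (W f) w) = cnj (h w)" for w
      by (simp only: ker[OF f] fock_reproducing_right[OF op_adjointD(2)[OF d h]])
    then have "C (W f) = h" by (simp add: fun_eq_iff)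
    then have "W f = C h" using conj_involutive by metis
    then show ?thesis using conj_Fock op_adjointD(2)[OF d h] by simp
  qed
  have "wco_max \<psi> \<phi> f = (if f \<in> Fock then map_option C (op_adjoint (wco_max \<psi> \<phi>) (C f)) else None)" for f
  proof (cases "f \<in> Fock \<and> W f \<in> Fock")
    case True
    then show ?thesis by (simp add: fwd conj_involutive) (simp add: wco_max_def W_def)
  next
    case False
    then have "wco_max \<psi> \<phi> f = None" by (simp add: wco_max_def W_def)
    moreover have "f \<in> Fock \<Longrightarrow> op_adjoint (wco_max \<psi> \<phi>) (C f) = None"
      using False bwd by (cases "op_adjoint (wco_max \<psi> \<phi>) (C f)") auto
    ultimately show ?thesis by auto
  qed
  then show ?thesis
    unfolding C_selfadjoint_def using d closed_op_wco_max by blast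
qed

text \<open>Passing from \<open>T\<close> to the larger \<open>S\<close> shrinks the adjoint;
  conjugating back gives \<open>S\<close> contained in \<open>T\<close>.\<close>

lemma selfadjoint_maximal:
  assumes T: "T \<subseteq>\<^sub>m S" and saT: "C_selfadjoint C T" and saS: "C_selfadjoint C S"
  shows "T = S"
proof (rule map_le_antisym[OF T])
  have eqT: "T = (\<lambda>f. if f \<in> Fock then map_option C (op_adjoint T (C f)) else None)"
    and eqS: "S = (\<lambda>f. if f \<in> Fock then map_option C (op_adjoint S (C f)) else None)"
    and d: "densely_defined T" "densely_defined S"
    using saT saS by (auto simp: C_selfadjoint_def)
  show "S \<subseteq>\<^sub>m T"
    unfolding map_le_def
  proof
    fix f assume "f \<in> dom S"
    then obtain g where g: "S f = Some g" by auto
    then have f: "f \<in> Fock" and "map_option C (op_adjoint S (C f)) = Some g"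
      using fun_cong[OF eqS, of f] by (auto split: if_splits)
    then obtain h where h: "op_adjoint S (C f) = Some h" "C h = g" by auto
    have "op_adjoint T (C f) = Some h"
      by (rule op_adjoint_antimono[OF T d(2,1) h(1)])
    then have "T f = Some g" using fun_cong[OF eqT, of f] f h(2) by simp
    then show "S f = T f" using g by simp
  qed
qed

end

theorem theorem1p2:
  fixes A :: "complex^'n^'n" and b :: "complex^'n" and c :: complex
    and \<psi> :: "complex^'n \<Rightarrow> complex" and \<phi> :: "complex^'n \<Rightarrow> complex^'n"
  assumes "invertible A" and "matrix_inv A = cadjoint A" and "cadjoint A = mconj A"
    and "A *v vconj b + b = 0"
    and "(cmod c)\<^sup>2 * exp ((norm b)\<^sup>2) = 1"
    and "entire \<psi>" and "\<psi> \<noteq> (\<lambda>_. 0)"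
    and "entire_map \<phi>"
  shows "(C_selfadjoint (conjABc A b c) (wco_max \<psi> \<phi>) \<longleftrightarrow> normal_form A b \<psi> \<phi>)
    \<and> (\<forall>T. T \<subseteq>\<^sub>m wco_max \<psi> \<phi> \<longrightarrow>
          (C_selfadjoint (conjABc A b c) T \<longleftrightarrow>
             T = wco_max \<psi> \<phi> \<and> normal_form A b \<psi> \<phi>))"
proof -
  interpret fock_conjugation A b c
    by unfold_locales (fact assms)+
  \<comment> \<open>Taking \<open>T\<close> to be the maximal operator gives necessity in the first
    part. For general \<open>T\<close> it makes the maximal operator a selfadjoint extension, which
    then coincides with \<open>T\<close>.\<close>
  have nf: "normal_form A b \<psi> \<phi>" if "T \<subseteq>\<^sub>m wco_max \<psi> \<phi>" "C_selfadjoint (conjABc A b c) T" for T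
    using normal_form_of_selfadjoint[OF that] assms by blast
  then show ?thesis
    using selfadjoint_of_normal_form selfadjoint_maximal map_le_refl by metis
qed

end
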